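(* Let $\tau\in\mathbb{C}$ with $\Im(\tau)>0$ and $q:=e^{\pi i\tau}$. Let $A=C^\infty(M_3)$, $A_n=\{f\in A:\mathfrak{t}f=nf\}$ for $n\in\mathbb{Z}$, and $A_{\mathrm{hol}}=\{f\in A:\mathfrak{q}f=0\}$. If $n<0$, then $A_{\mathrm{hol}}\cap A_n=\{0\}$. If $n>0$, elements $f\in A_{\mathrm{hol}}\cap A_n$ are in bijection with elements $c_f\in\mathbb{C}^{\mathbb{Z}/n\mathbb{Z}}$ via the formula $$f(z,t)=e^{\pi i n\{\frac{1}{\Im(\tau)}t+xy+\tau y^2\}}\sum_{k\in\mathbb{Z}}c_f(k)\,q^{k^2/n}e^{2\pi i k z},$$ where $x,y\in\mathbb{R}$ are the real coordinates defined by $z=x+\tau y$.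
   Context: The Heisenberg group is realized as $H_3(\mathbb{R}):=\mathbb{C}\times\mathbb{R}$ with multiplication $(z_1,t_1)\cdot(z_2,t_2)=(z_1+z_2,\,t_1+t_2+\Im(\bar z_1z_2))$, and $H_3(\mathbb{Z})\subset H_3(\mathbb{R})$ is the subgroup generated by $(1,0)$ and $(\tau,0)$. $M_3:=H_3(\mathbb{R})/H_3(\mathbb{Z})$, and $C^\infty(M_3)$ is identified with the smooth complex functions $f(z,t)$ on $H_3(\mathbb{R})$ that are invariant under right multiplication by $H_3(\mathbb{Z})$. The differential operators $$\mathfrak{q}=\sqrt{\tfrac{\Im(\tau)}{\pi}}\Big(\tfrac{\partial}{\partial\bar z}-\tfrac{iz}{2}\tfrac{\partial}{\partial t}\Big),\qquad \mathfrak{t}=\tfrac{\Im(\tau)}{\pi i}\tfrac{\partial}{\partial t}$$ are right invariant vector fields on $H_3(\mathbb{R})$ and so act on $C^\infty(M_3)$. Elements of $\mathbb{C}^{\mathbb{Z}/n\mathbb{Z}}$ are viewed as $n$-periodic functions $c:\mathbb{Z}\to\mathbb{C}$; $q^{s}$ means $e^{\pi i\tau s}$ for real $s$. *)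

theory Defs
  imports "HOL-Analysis.Analysis" "HOL-Algebra.Generated_Groups"
begin

definition heisenberg :: "(complex \<times> real) monoid" where
  "heisenberg =
     \<lparr>carrier = UNIV,
      mult = (\<lambda>(z1, t1) (z2, t2). (z1 + z2, t1 + t2 + Im (cnj z1 * z2))),
      one = (0, 0)\<rparr>"

lemma group_heisenberg: "group heisenberg"
proof (rule groupI)
  fix p assume "p \<in> carrier heisenberg"
  obtain z t where p: "p = (z, t)" by (cases p)
  show "\<exists>q\<in>carrier heisenberg. q \<otimes>\<^bsub>heisenberg\<^esub> p = \<one>\<^bsub>heisenberg\<^esub>"
    by (rule bexI[of _ "(- z, - t)"]) (auto simp: heisenberg_def p)
qed (auto simp: heisenberg_def algebra_simps)

definition heisenberg_int :: "complex \<Rightarrow> (complex \<times> real) set" where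
  "heisenberg_int \<tau> = generate heisenberg {(1, 0), (\<tau>, 0)}"

lemma subgroup_heisenberg_int: "subgroup (heisenberg_int \<tau>) heisenberg"
  unfolding heisenberg_int_def
  by (rule group.generate_is_subgroup[OF group_heisenberg]) (simp add: heisenberg_def)

text \<open>All iterated directional derivatives up to order \<open>k\<close> exist, and those below order \<open>k\<close>
  are Frechet differentiable everywhere; quantifying over all \<open>k\<close> gives smoothness.\<close>

fun times_differentiable ::
    "nat \<Rightarrow> ('a::real_normed_vector \<Rightarrow> 'b::real_normed_vector) \<Rightarrow> bool" where
  "times_differentiable 0 f \<longleftrightarrow> continuous_on UNIV f"
| "times_differentiable (Suc k) f \<longleftrightarrow>
     (\<forall>p. f differentiable (at p)) \<and>
     (\<forall>v. times_differentiable k (\<lambda>p. frechet_derivative f (at p) v))"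

definition smooth :: "('a::euclidean_space \<Rightarrow> 'b::real_normed_vector) \<Rightarrow> bool" where
  "smooth f \<longleftrightarrow> (\<forall>k. times_differentiable k f)"

text \<open>\<open>C\<^sup>\<infinity>(M\<^sub>3)\<close>, where \<open>M\<^sub>3\<close> is the space of left cosets \<open>p H\<^sub>3(\<int>)\<close>, as smooth functions on
  the Heisenberg group invariant under right multiplication by \<open>H\<^sub>3(\<int>)\<close>.\<close>

definition smooth_M3 :: "complex \<Rightarrow> (complex \<times> real \<Rightarrow> complex) set" where
  "smooth_M3 \<tau> =
     {f. smooth f \<and> (\<forall>p. \<forall>\<gamma>\<in>heisenberg_int \<tau>. f (p \<otimes>\<^bsub>heisenberg\<^esub> \<gamma>) = f p)}"

definition d_t :: "(complex \<times> real \<Rightarrow> complex) \<Rightarrow> complex \<times> real \<Rightarrow> complex" where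
  "d_t f p = frechet_derivative f (at p) (0, 1)"

text \<open>The Wirtinger derivative in the first variable, with respect to the standard real and
  imaginary parts of \<open>z\<close> (not the coordinates of \<open>z\<close> in the basis \<open>1, \<tau>\<close>).\<close>

definition d_zbar :: "(complex \<times> real \<Rightarrow> complex) \<Rightarrow> complex \<times> real \<Rightarrow> complex" where
  "d_zbar f p =
     (frechet_derivative f (at p) (1, 0) + \<i> * frechet_derivative f (at p) (\<i>, 0)) / 2"

definition q_op ::
    "complex \<Rightarrow> (complex \<times> real \<Rightarrow> complex) \<Rightarrow> complex \<times> real \<Rightarrow> complex" where
  "q_op \<tau> f = (\<lambda>(z, t).
     of_real (sqrt (Im \<tau> / pi)) * (d_zbar f (z, t) - \<i> * z / 2 * d_t f (z, t)))"

definition t_op ::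
    "complex \<Rightarrow> (complex \<times> real \<Rightarrow> complex) \<Rightarrow> complex \<times> real \<Rightarrow> complex" where
  "t_op \<tau> f = (\<lambda>p. of_real (Im \<tau>) / (of_real pi * \<i>) * d_t f p)"

definition A_weight :: "complex \<Rightarrow> int \<Rightarrow> (complex \<times> real \<Rightarrow> complex) set" where
  "A_weight \<tau> n = {f \<in> smooth_M3 \<tau>. t_op \<tau> f = (\<lambda>p. of_int n * f p)}"

definition A_hol :: "complex \<Rightarrow> (complex \<times> real \<Rightarrow> complex) set" where
  "A_hol \<tau> = {f \<in> smooth_M3 \<tau>. q_op \<tau> f = (\<lambda>p. 0)}"

definition periodic_int :: "int \<Rightarrow> (int \<Rightarrow> complex) set" where
  "periodic_int n = {c. \<forall>k. c (k + n) = c k}"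

text \<open>The power \<open>q\<^sup>s\<close> for \<open>q = e\<^sup>\<pi>\<^sup>i\<^sup>\<tau>\<close>; it depends on \<open>\<tau>\<close> and not only on \<open>q\<close>.\<close>

definition q_pow :: "complex \<Rightarrow> real \<Rightarrow> complex" where
  "q_pow \<tau> s = exp (of_real pi * \<i> * \<tau> * of_real s)"

end

theory Submission
  imports Defs "HOL-Complex_Analysis.Complex_Analysis"
begin

text \<open>Write \<open>z = x + \<tau> y\<close>. The two differential equations say exactly that
  \<open>f(z,t) = e\<^bsup>\<pi>in(t/Im \<tau> + yz)\<^esup> H(z)\<close> with \<open>H\<close> entire, where \<open>yz = xy + \<tau>y\<^sup>2\<close>, and
  invariance under the two generators becomes \<open>H(z + 1) = H(z)\<close> and
  \<open>e\<^bsup>\<pi>in(2z + \<tau>)\<^esup> H(z + \<tau>) = H(z)\<close>. Expanding \<open>H\<close> in a Fourier series with coefficients \<open>a\<^sub>k\<close>,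
  the second condition reads \<open>a\<^bsub>k+n\<^esub> = q\<^bsup>2k+n\<^esup> a\<^sub>k\<close>, that is, \<open>c\<^sub>k = q\<^bsup>-k\<^sup>2/n\<^esup> a\<^sub>k\<close> is
  \<open>n\<close>-periodic. For \<open>n > 0\<close> every periodic \<open>c\<close> gives a convergent series, while for \<open>n < 0\<close> the
  \<open>a\<^sub>k\<close> could only be bounded if \<open>c = 0\<close>.\<close>

subsection \<open>Means of periodic entire functions\<close>

definition fmode :: "int \<Rightarrow> complex \<Rightarrow> complex" where
  "fmode k z = exp (2 * of_real pi * \<i> * of_int k * z)"

lemma fmode_0 [simp]: "fmode 0 z = 1"
  by (simp add: fmode_def)

lemma fmode_add_index: "fmode (j + k) z = fmode j z * fmode k z"
  by (simp add: fmode_def exp_add [symmetric] algebra_simps)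

lemma fmode_add: "fmode k (z + w) = fmode k z * fmode k w"
  by (simp add: fmode_def exp_add [symmetric] algebra_simps)

lemma fmode_eq_1_int: "fmode k (of_int m) = 1"
proof -
  have "fmode k (of_int m) = exp (2 * of_int (k * m) * of_real pi * \<i>)"
    by (simp add: fmode_def algebra_simps)
  also have "\<dots> = 1"
    using exp_integer_2pi [of "of_int (k * m)"] by (simp add: algebra_simps)
  finally show ?thesis .
qed

lemma fmode_add_1: "fmode k (z + 1) = fmode k z"
  using fmode_eq_1_int [of k 1] by (simp add: fmode_add)

lemma norm_fmode: "norm (fmode k z) = exp (- (2 * pi * of_int k * Im z))"
  by (simp add: fmode_def)

lemma holomorphic_on_fmode [holomorphic_intros]:
  "f holomorphic_on A \<Longrightarrow> (\<lambda>z. fmode k (f z)) holomorphic_on A"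
  unfolding fmode_def by (intro holomorphic_intros)

lemma has_field_derivative_fmode:
  "(fmode k has_field_derivative 2 * of_real pi * \<i> * of_int k * fmode k z) (at z)"
  unfolding fmode_def by (auto intro!: derivative_eq_intros)

section \<open>Closure properties of periodic entire functions\<close>

definition periodic_entire :: "(complex \<Rightarrow> complex) set" where
  "periodic_entire = {h. h holomorphic_on UNIV \<and> (\<forall>z. h (z + 1) = h z)}"

lemma periodic_entire_mult:
  "g \<in> periodic_entire \<Longrightarrow> h \<in> periodic_entire \<Longrightarrow> (\<lambda>z. g z * h z) \<in> periodic_entire"
  by (auto simp: periodic_entire_def intro!: holomorphic_intros)

lemma periodic_entire_fmode_shift: "(\<lambda>z. fmode k (z - w)) \<in> periodic_entire"
  using fmode_add_1 [of k "_ - w"]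
  by (auto simp: periodic_entire_def algebra_simps intro!: holomorphic_intros)

lemma periodic_entire_fmode: "fmode k \<in> periodic_entire"
  using periodic_entire_fmode_shift [of k 0] by simp

lemma periodic_entire_cmult: "h \<in> periodic_entire \<Longrightarrow> (\<lambda>z. c * h z) \<in> periodic_entire"
  by (auto simp: periodic_entire_def intro!: holomorphic_intros)

lemma periodic_entire_diff:
  "g \<in> periodic_entire \<Longrightarrow> h \<in> periodic_entire \<Longrightarrow> (\<lambda>z. g z - h z) \<in> periodic_entire"
  by (auto simp: periodic_entire_def intro!: holomorphic_intros)

lemma periodic_entire_sum:
  "(\<And>x. x \<in> X \<Longrightarrow> h x \<in> periodic_entire) \<Longrightarrow> (\<lambda>z. \<Sum>x\<in>X. h x z) \<in> periodic_entire"
  by (auto simp: periodic_entire_def intro!: holomorphic_intros)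

lemma periodic_entire_shift:
  assumes "h \<in> periodic_entire"
  shows "(\<lambda>z. h (z + a)) \<in> periodic_entire"
proof -
  have "h holomorphic_on UNIV"
    using assms by (simp add: periodic_entire_def)
  then have "(\<lambda>z. h (z + a)) holomorphic_on UNIV"
    by (rule holomorphic_on_compose_gen [unfolded o_def, rotated]) (auto intro: holomorphic_intros)
  moreover have "h (z + 1 + a) = h (z + a)" for z
  proof -
    have "h ((z + a) + 1) = h (z + a)"
      using assms by (simp add: periodic_entire_def)
    then show ?thesis by (simp add: ac_simps)
  qed
  ultimately show ?thesis by (simp add: periodic_entire_def)
qed

text \<open>This is the integral of h over [0, 1], encoded as the increment of a primitive. An
  entire h always has a primitive, and the increment does not depend on which one is chosen.\<close>

definition period_mean :: "(complex \<Rightarrow> complex) \<Rightarrow> complex" where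
  "period_mean h = (SOME m. \<exists>P. (\<forall>z. (P has_field_derivative h z) (at z)) \<and> m = P 1 - P 0)"

text \<open>The function \<open>P (z + 1) - P z\<close> has derivative
  \<open>h (z + 1) - h z = 0\<close>.\<close>

lemma primitive_diff_shift_constant:
  assumes per: "\<And>z. h (z + 1) = h z"
    and P: "\<And>z. (P has_field_derivative h z) (at z)"
  shows "P (w + 1) - P w = P (v + 1) - P (v :: complex)"
proof -
  have "((\<lambda>z. P (z + 1) - P z) has_field_derivative 0) (at z)" for z
  proof -
    have "((\<lambda>z. P (z + 1)) has_field_derivative h (z + 1)) (at z)"
      using P [of "z + 1"] by (simp add: DERIV_shift)
    from DERIV_diff [OF this P [of z]] show ?thesis
      by (simp add: per)
  qed
  then have "\<exists>c. \<forall>z\<in>UNIV. P (z + 1) - P z = c"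
    by (intro has_field_derivative_zero_constant) auto
  then show ?thesis by force
qed

text \<open>Independence of the base point replaces shifting the contour of integration.\<close>

lemma period_mean_eq:
  assumes per: "\<And>z. h (z + 1) = h z"
    and P: "\<And>z. (P has_field_derivative h z) (at z)"
  shows "period_mean h = P (w + 1) - P w"
proof -
  have "\<exists>m. \<exists>P. (\<forall>z. (P has_field_derivative h z) (at z)) \<and> m = P 1 - P 0"
    using P by blast
  from someI_ex [OF this] obtain Q where Q: "\<And>z. (Q has_field_derivative h z) (at z)"
    and m: "period_mean h = Q 1 - Q 0"
    unfolding period_mean_def by blast
  have "((\<lambda>z. Q z - P z) has_field_derivative 0) (at z)" for z
    using DERIV_diff [OF Q P] by simp
  then have "\<exists>c. \<forall>z\<in>UNIV. Q z - P z = c"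
    by (intro has_field_derivative_zero_constant) auto
  then have "Q 1 - P 1 = Q 0 - P 0" by force
  then have "Q 1 - Q 0 = P 1 - P 0" by (simp add: algebra_simps)
  then have "period_mean h = P (0 + 1) - P 0"
    using m by simp
  also have "\<dots> = P (w + 1) - P w"
    using per P by (rule primitive_diff_shift_constant)
  finally show ?thesis .
qed

lemma entire_primitive:
  assumes "h holomorphic_on UNIV"
  obtains P where "\<And>z. (P has_field_derivative h z) (at z)"
  using holomorphic_convex_primitive' [of UNIV h] assms by auto

lemma periodic_entire_primitive:
  assumes "h \<in> periodic_entire"
  obtains P where "\<And>z. (P has_field_derivative h z) (at z)"
    "\<And>w. period_mean h = P (w + 1) - P w"
proof -
  have h: "h holomorphic_on UNIV" "\<And>z. h (z + 1) = h z"
    using assms by (auto simp: periodic_entire_def)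
  obtain P where P: "\<And>z. (P has_field_derivative h z) (at z)"
    using entire_primitive [OF h(1)] by blast
  show ?thesis
    using that [OF P] period_mean_eq [OF h(2) P] by blast
qed

lemma period_mean_add:
  assumes "g \<in> periodic_entire" "h \<in> periodic_entire"
  shows "period_mean (\<lambda>z. g z + h z) = period_mean g + period_mean h"
proof -
  obtain P where P: "\<And>z. (P has_field_derivative g z) (at z)"
    "\<And>w. period_mean g = P (w + 1) - P w"
    using assms(1) by (rule periodic_entire_primitive) blast
  obtain Q where Q: "\<And>z. (Q has_field_derivative h z) (at z)"
    "\<And>w. period_mean h = Q (w + 1) - Q w"
    using assms(2) by (rule periodic_entire_primitive) blast
  have "period_mean (\<lambda>z. g z + h z) = (P (0 + 1) + Q (0 + 1)) - (P 0 + Q 0)"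
    by (rule period_mean_eq [where P = "\<lambda>z. P z + Q z"])
       (use assms P(1) Q(1) in \<open>auto simp: periodic_entire_def intro: DERIV_add\<close>)
  then show ?thesis using P(2) [of 0] Q(2) [of 0] by simp
qed

lemma period_mean_cmult:
  assumes "h \<in> periodic_entire"
  shows "period_mean (\<lambda>z. c * h z) = c * period_mean h"
proof -
  obtain P where P: "\<And>z. (P has_field_derivative h z) (at z)"
    "\<And>w. period_mean h = P (w + 1) - P w"
    using assms by (rule periodic_entire_primitive) blast
  have "period_mean (\<lambda>z. c * h z) = c * P (0 + 1) - c * P 0"
    by (rule period_mean_eq [where P = "\<lambda>z. c * P z"])
       (use assms P(1) in \<open>auto simp: periodic_entire_def intro: DERIV_cmult\<close>)
  then show ?thesis using P(2) [of 0] by (simp add: right_diff_distrib)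
qed

lemma period_mean_diff:
  assumes "g \<in> periodic_entire" "h \<in> periodic_entire"
  shows "period_mean (\<lambda>z. g z - h z) = period_mean g - period_mean h"
  using period_mean_add [OF assms(1) periodic_entire_cmult [OF assms(2)], of "- 1"]
    period_mean_cmult [OF assms(2), of "- 1"] by simp

lemma period_mean_sum:
  assumes "\<And>x. x \<in> X \<Longrightarrow> h x \<in> periodic_entire"
  shows "period_mean (\<lambda>z. \<Sum>x\<in>X. h x z) = (\<Sum>x\<in>X. period_mean (h x))"
  using assms
proof (induction X rule: infinite_finite_induct)
  case (insert x X)
  then show ?case
    by (simp add: period_mean_add periodic_entire_sum)
\<comment> \<open>Empty and infinite index sets both give the zero function, whose mean is found by
  writing it as 0 times a mode.\<close>
qed (use period_mean_cmult [OF periodic_entire_fmode, of 0] in auto)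

text \<open>\<open>P (z + a)\<close> is a primitive of the shifted function, so its mean is the
  increment of P from a to a + 1, which is the same from every base point. For non-real a this moves
  the path of integration vertically.\<close>

lemma period_mean_shift:
  assumes "h \<in> periodic_entire"
  shows "period_mean (\<lambda>z. h (z + a)) = period_mean h"
proof -
  obtain P where P: "\<And>z. (P has_field_derivative h z) (at z)"
    "\<And>w. period_mean h = P (w + 1) - P w"
    using assms by (rule periodic_entire_primitive) blast
  have "h (z + 1 + a) = h (z + a)" for z
    using periodic_entire_shift [OF assms, of a] by (simp add: periodic_entire_def)
  moreover have "((\<lambda>z. P (z + a)) has_field_derivative h (z + a)) (at z)" for z
    using P(1) [of "z + a"] by (simp add: DERIV_shift)
  ultimately have "period_mean (\<lambda>z. h (z + a)) = P (0 + 1 + a) - P (0 + a)"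
    by (rule period_mean_eq [where P = "\<lambda>z. P (z + a)"])
  then show ?thesis using P(2) [of a] by (simp add: add.commute)
qed

text \<open>Mean value inequality on a segment of length 1. The base point w is free, so the bound
  may be taken at any height.\<close>

lemma norm_period_mean_le:
  assumes "h \<in> periodic_entire" "\<And>z. z \<in> closed_segment w (w + 1) \<Longrightarrow> norm (h z) \<le> B"
  shows "norm (period_mean h) \<le> B"
proof -
  obtain P where P: "\<And>z. (P has_field_derivative h z) (at z)"
    "\<And>w. period_mean h = P (w + 1) - P w"
    using assms(1) by (rule periodic_entire_primitive) blast
  have "norm (P (w + 1) - P w) \<le> B * norm (w + 1 - w)"
    by (rule field_differentiable_bound [where S = "closed_segment w (w + 1)" and f' = h])
       (use assms P(1) in \<open>auto intro: has_field_derivative_at_within\<close>)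
  then show ?thesis using P(2) [of w] by simp
qed

text \<open>For nonzero k a constant multiple of the mode is a primitive of it, and by periodicity
  its increment vanishes; for k = 0 the primitive is z.\<close>

lemma period_mean_fmode: "period_mean (fmode k) = (if k = 0 then 1 else 0)"
proof (cases "k = 0")
  case True
  have "period_mean (fmode 0) = (\<lambda>z. z) (0 + 1) - (\<lambda>z. z) 0"
    by (rule period_mean_eq) (auto simp: fmode_add_1)
  then show ?thesis using True by simp
next
  case False
  have "period_mean (fmode k) = fmode k (0 + 1) / (2 * of_real pi * \<i> * of_int k)
      - fmode k 0 / (2 * of_real pi * \<i> * of_int k)"
  proof (rule period_mean_eq [where P = "\<lambda>z. fmode k z / (2 * of_real pi * \<i> * of_int k)"])
    show "((\<lambda>z. fmode k z / (2 * of_real pi * \<i> * of_int k)) has_field_derivative fmode k z) (at z)" for z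
      using DERIV_cdivide [OF has_field_derivative_fmode [of k z], of "2 * of_real pi * \<i> * of_int k"] False
      by simp
  qed (rule fmode_add_1)
  then show ?thesis using False fmode_add_1 [of k 0] by simp
qed

lemma periodic_entire_bounded_segment:
  assumes "h \<in> periodic_entire"
  obtains B where "B \<ge> 0" "\<And>z. z \<in> closed_segment w (w + 1) \<Longrightarrow> norm (h z) \<le> B"
proof -
  have "compact (h ` closed_segment w (w + 1))"
    using assms
    by (intro compact_continuous_image holomorphic_on_imp_continuous_on)
       (auto simp: periodic_entire_def intro: holomorphic_on_subset)
  then obtain B where "\<forall>y\<in>h ` closed_segment w (w + 1). norm y \<le> B"
    using compact_imp_bounded bounded_iff by metis
  then have "\<And>z. z \<in> closed_segment w (w + 1) \<Longrightarrow> norm (h z) \<le> max 0 B"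
    by force
  then show ?thesis using that [of "max 0 B"] by simp
qed

lemma Im_closed_segment_1: "z \<in> closed_segment w (w + 1) \<Longrightarrow> Im z = Im w"
  by (auto simp: closed_segment_def algebra_simps)

text \<open>The modulus of \<open>fmode (- k) (z - w)\<close> is constant on the horizontal line
  through v. Taking v below w gives decay as k grows, taking it above w gives decay as k tends to
  minus infinity.\<close>

lemma norm_period_mean_fmode_le:
  assumes h: "h \<in> periodic_entire"
    and B: "\<And>z. z \<in> closed_segment v (v + 1) \<Longrightarrow> norm (h z) \<le> B"
  shows "norm (period_mean (\<lambda>z. h z * fmode (- k) (z - w))) \<le> B * exp (2 * pi * k * (Im v - Im w))"
proof (rule norm_period_mean_le)
  show "(\<lambda>z. h z * fmode (- k) (z - w)) \<in> periodic_entire"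
    by (intro periodic_entire_mult h periodic_entire_fmode_shift)
  fix z assume z: "z \<in> closed_segment v (v + 1)"
  then show "norm (h z * fmode (- k) (z - w)) \<le> B * exp (2 * pi * k * (Im v - Im w))"
    using B [OF z] Im_closed_segment_1 [OF z]
    by (simp add: norm_mult norm_fmode mult_right_mono algebra_simps)
qed

text \<open>Locates the zeros of the divisor \<open>fmode 1 (z - w) - 1\<close>: the integer
  translates of w.\<close>

lemma fmode_1_eq_1_iff: "fmode 1 z = 1 \<longleftrightarrow> (\<exists>m. z = of_int m)"
proof
  assume "fmode 1 z = 1"
  then obtain m :: int where "Re (2 * of_real pi * \<i> * z) = 0"
     "Im (2 * of_real pi * \<i> * z) = of_int (2 * m) * pi"
    unfolding fmode_def exp_eq_1 by auto
  then have "Re z = of_int m" "Im z = 0" by auto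
  then show "\<exists>m. z = of_int m" by (auto simp: complex_eq_iff)
qed (use fmode_eq_1_int in auto)

lemma sum_telescope_int:
  fixes \<kappa> :: "int \<Rightarrow> 'a :: ab_group_add"
  shows "(\<Sum>k\<in>{- int N..int N}. \<kappa> (k - 1) - \<kappa> k) = \<kappa> (- int N - 1) - \<kappa> (int N)"
proof (induction N)
  case (Suc N)
  have "{- int (Suc N)..int (Suc N)} = insert (- int N - 1) (insert (int N + 1) {- int N..int N})"
    by auto
  then have "(\<Sum>k\<in>{- int (Suc N)..int (Suc N)}. \<kappa> (k - 1) - \<kappa> k)
     = (\<kappa> (- 2 - int N) - \<kappa> (- int N - 1)) + ((\<kappa> (int N) - \<kappa> (int N + 1)) + (\<kappa> (- int N - 1) - \<kappa> (int N)))"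
    using Suc by simp
  also have "\<dots> = \<kappa> (- 2 - int N) - \<kappa> (int N + 1)"
    by simp
  also have "\<dots> = \<kappa> (- int (Suc N) - 1) - \<kappa> (int (Suc N))"
    by (rule arg_cong2 [where f = minus]; rule arg_cong [where f = \<kappa>]; simp)
  finally show ?case .
qed simp

subsection \<open>Fourier expansion of periodic entire functions\<close>

lemma periodic_entire_of_int:
  assumes "h \<in> periodic_entire"
  shows "h (z + of_int m) = h z"
proof -
  have step: "h (v + 1) = h v" for v
    using assms by (simp add: periodic_entire_def)
  have nat: "h (v + of_nat n) = h v" for v n
  proof (induction n)
    case (Suc n)
    then show ?case using step [of "v + of_nat n"] by (simp add: ac_simps)
  qed simp
  show ?thesis
  proof (cases m rule: int_cases2)
    case (nonneg n)
    then show ?thesis using nat by simp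
  next
    case (nonpos n)
    then show ?thesis using nat [of "z - of_nat n" n] by simp
  qed
qed

text \<open>The divisor has simple zeros, exactly at the integer translates of w, and there
  \<open>h z - h w\<close> vanishes by periodicity. So the quotient has only removable
  singularities.\<close>

lemma periodic_divided_difference:
  assumes h: "h \<in> periodic_entire"
  obtains K where "K \<in> periodic_entire" "\<And>z. h z - h w = (fmode 1 (z - w) - 1) * K z"
proof -
  \<comment> \<open>At the zeros the value is the ratio of the derivatives at w of numerator and
    divisor, the latter being 2 pi i.\<close>
  define K where "K = (\<lambda>z. if fmode 1 (z - w) = 1 then deriv h w / (2 * of_real pi * \<i>)
    else (h z - h w) / (fmode 1 (z - w) - 1))"
  have holh: "h holomorphic_on UNIV"
    using h by (simp add: periodic_entire_def)
  have per: "K (z + 1) = K z" for z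
  proof -
    have "fmode 1 (z + 1 - w) = fmode 1 (z - w)"
      using fmode_add_1 [of 1 "z - w"] by (simp add: diff_add_eq)
    then show ?thesis
      using h by (simp add: K_def periodic_entire_def)
  qed
  have eq: "h z - h w = (fmode 1 (z - w) - 1) * K z" for z
  proof (cases "fmode 1 (z - w) = 1")
    case True
    then obtain m where "z - w = of_int m"
      using fmode_1_eq_1_iff by blast
    then have "z = w + of_int m" by (simp add: algebra_simps)
    then show ?thesis
      using periodic_entire_of_int [OF h, of w m] True by simp
  qed (simp add: K_def)
  have hol1: "K holomorphic_on {z. fmode 1 (z - w) \<noteq> 1}"
  proof (rule holomorphic_transform)
    show "(\<lambda>z. (h z - h w) / (fmode 1 (z - w) - 1)) holomorphic_on {z. fmode 1 (z - w) \<noteq> 1}"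
      by (intro holomorphic_intros holomorphic_on_subset [OF holh]) auto
  qed (simp add: K_def)
  have "open (- {z. fmode 1 (z - w) = 1})"
    unfolding fmode_def by (intro open_Compl closed_Collect_eq continuous_intros)
  then have op: "open {z. fmode 1 (z - w) \<noteq> 1}"
    by (simp add: Collect_neg_eq)
  \<comment> \<open>Distinct zeros of the divisor are at distance at least 1, so w is the only one
    in the open unit ball around it.\<close>
  have ball: "fmode 1 (z - w) \<noteq> 1" if "z \<in> ball w 1 - {w}" for z
  proof
    assume "fmode 1 (z - w) = 1"
    then obtain m where m: "z - w = of_int m"
      using fmode_1_eq_1_iff by blast
    then have "cmod (of_int m) < 1"
      using that by (metis DiffD1 dist_commute dist_norm mem_ball)
    then have "m = 0" by (simp add: norm_of_int)
    then show False using m that by simp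
  qed
  \<comment> \<open>Dividing numerator and denominator by z - w turns K into a ratio of two
    difference quotients.\<close>
  have cont: "isCont K w"
  proof -
    have "((\<lambda>z. (h z - h w) / (z - w)) \<longlongrightarrow> deriv h w) (at w)"
      using holomorphic_derivI [OF holh, of w] by (simp add: has_field_derivative_iff)
    moreover have "((\<lambda>z. fmode 1 (z - w)) has_field_derivative 2 * of_real pi * \<i>) (at w)"
      unfolding fmode_def by (auto intro!: derivative_eq_intros)
    then have "((\<lambda>z. (fmode 1 (z - w) - 1) / (z - w)) \<longlongrightarrow> 2 * of_real pi * \<i>) (at w)"
      by (simp add: has_field_derivative_iff fmode_def)
    ultimately have "((\<lambda>z. ((h z - h w) / (z - w)) / ((fmode 1 (z - w) - 1) / (z - w)))
        \<longlongrightarrow> deriv h w / (2 * of_real pi * \<i>)) (at w)"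
      by (rule tendsto_divide) simp
    moreover have "\<forall>\<^sub>F z in at w.
        ((h z - h w) / (z - w)) / ((fmode 1 (z - w) - 1) / (z - w)) = K z"
      unfolding eventually_at
      by (rule exI [of _ 1]) (use ball in \<open>auto simp: K_def dist_commute\<close>)
    ultimately have "(K \<longlongrightarrow> deriv h w / (2 * of_real pi * \<i>)) (at w)"
      by (rule Lim_transform_eventually)
    then show ?thesis
      by (simp add: isCont_def K_def fmode_def)
  qed
  have hol2: "K holomorphic_on ball w 1"
  proof (rule no_isolated_singularity [where K = "{w}"])
    show hd: "K holomorphic_on ball w 1 - {w}"
      by (rule holomorphic_on_subset [OF hol1]) (use ball in blast)
    have "isCont K z" if "z \<in> ball w 1" for z
    proof (cases "z = w")
      case False
      then show ?thesis
        using holomorphic_on_imp_continuous_on [OF hd] that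
        by (metis Diff_iff continuous_on_eq_continuous_at open_ball open_delete singletonD)
    qed (use cont in simp)
    then show "continuous_on (ball w 1) K"
      by (simp add: continuous_at_imp_continuous_on)
  qed auto
  have "K field_differentiable at z" for z
  proof (cases "fmode 1 (z - w) = 1")
    \<comment> \<open>Differentiability at w is carried to the other zeros by the periodicity of
      K.\<close>
    case True
    then obtain m where m: "z - w = of_int m"
      using fmode_1_eq_1_iff by blast
    have K_int: "K (v + of_int m) = K v" for v
    proof -
      have "fmode 1 (v + of_int m - w) = fmode 1 (v - w)"
        using fmode_add [of 1 "v - w" "of_int m"] by (simp add: fmode_eq_1_int diff_add_eq)
      then show ?thesis
        by (simp add: K_def periodic_entire_of_int [OF h])
    qed
    have "K field_differentiable at w"
      using hol2 by (simp add: holomorphic_on_imp_differentiable_at)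
    then obtain d where "(K has_field_derivative d) (at w)"
      by (auto simp: field_differentiable_def)
    then have "((\<lambda>v. K (v + of_int (- m))) has_field_derivative d) (at z)"
      using DERIV_shift [of K d z "of_int (- m)"] m by (simp add: algebra_simps)
    moreover have "K (v + of_int (- m)) = K v" for v
      using K_int [of "v + of_int (- m)"] by simp
    ultimately show ?thesis
      by (auto simp: field_differentiable_def)
  next
    case False
    then show ?thesis
      using holomorphic_on_imp_differentiable_at [OF hol1 op] by simp
  qed
  then have "K \<in> periodic_entire"
    using per by (auto simp: periodic_entire_def holomorphic_on_def
        intro: field_differentiable_at_within)
  then show ?thesis using that eq by blast
qed

definition fourier_coeff :: "(complex \<Rightarrow> complex) \<Rightarrow> int \<Rightarrow> complex" where
  "fourier_coeff h k = period_mean (\<lambda>z. h z * fmode (- k) z)"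

text \<open>Chernoff's argument: dividing by \<open>fmode 1 (z - w) - 1\<close> turns the partial
  sums into telescoping ones.\<close>

lemma fourier_partial_sums:
  assumes h: "h \<in> periodic_entire"
  shows "(\<lambda>N. \<Sum>k\<in>{- int N..int N}. fourier_coeff h k * fmode k w) \<longlonglongrightarrow> h w"
proof -
  obtain K where K: "K \<in> periodic_entire"
    and eq: "\<And>z. h z - h w = (fmode 1 (z - w) - 1) * K z"
    using periodic_divided_difference [OF h] by metis
  define \<kappa> where "\<kappa> k = period_mean (\<lambda>z. K z * fmode (- k) (z - w))" for k
  \<comment> \<open>\<open>\<kappa> k\<close> is the k-th Fourier coefficient of K recentred at w,
    and multiplying K by \<open>fmode 1 (z - w)\<close> replaces it by
    \<open>\<kappa> (k - 1)\<close>. The constant \<open>h w\<close> contributes only at k = 0, by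
    orthogonality of the modes.\<close>
  have tele: "fourier_coeff h k * fmode k w - (if k = 0 then h w else 0) = \<kappa> (k - 1) - \<kappa> k" for k
  proof -
    have hf: "(\<lambda>z. h z * fmode (- k) z) \<in> periodic_entire"
      by (intro periodic_entire_mult h periodic_entire_fmode)
    have "\<kappa> (k - 1) - \<kappa> k
        = period_mean (\<lambda>z. K z * fmode (- (k - 1)) (z - w) - K z * fmode (- k) (z - w))"
      unfolding \<kappa>_def by (intro period_mean_diff [symmetric] periodic_entire_mult K
          periodic_entire_fmode_shift)
    also have "(\<lambda>z. K z * fmode (- (k - 1)) (z - w) - K z * fmode (- k) (z - w))
        = (\<lambda>z. fmode k w * (h z * fmode (- k) z) - (h w * fmode k w) * fmode (- k) z)"
    proof
      fix z
      have "fmode (- (k - 1)) (z - w) = fmode 1 (z - w) * fmode (- k) (z - w)"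
        using fmode_add_index [of 1 "- k" "z - w"] by (simp add: algebra_simps)
      then have "K z * fmode (- (k - 1)) (z - w) - K z * fmode (- k) (z - w)
          = ((fmode 1 (z - w) - 1) * K z) * fmode (- k) (z - w)"
        by (simp add: algebra_simps)
      also have "\<dots> = (h z - h w) * fmode (- k) (z - w)"
        by (simp add: eq)
      also have "\<dots> = (h z - h w) * (fmode (- k) z * fmode k w)"
        by (simp add: fmode_def flip: exp_add) (simp add: right_diff_distrib)
      also have "\<dots> = fmode k w * (h z * fmode (- k) z) - (h w * fmode k w) * fmode (- k) z"
        by (simp add: algebra_simps)
      finally show "K z * fmode (- (k - 1)) (z - w) - K z * fmode (- k) (z - w)
          = fmode k w * (h z * fmode (- k) z) - (h w * fmode k w) * fmode (- k) z" .
    qed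
    also have "period_mean \<dots> = period_mean (\<lambda>z. fmode k w * (h z * fmode (- k) z))
        - period_mean (\<lambda>z. (h w * fmode k w) * fmode (- k) z)"
      by (intro period_mean_diff periodic_entire_cmult [OF hf]
          periodic_entire_cmult [OF periodic_entire_fmode])
    also have "\<dots> = fmode k w * fourier_coeff h k - (h w * fmode k w) * period_mean (fmode (- k))"
      by (simp only: fourier_coeff_def period_mean_cmult [OF hf]
          period_mean_cmult [OF periodic_entire_fmode])
    finally show ?thesis
      by (simp add: period_mean_fmode)
  qed
  have "(\<Sum>k\<in>{- int N..int N}. fourier_coeff h k * fmode k w) - h w = \<kappa> (- int N - 1) - \<kappa> (int N)" for N
  proof -
    have "(\<Sum>k\<in>{- int N..int N}. fourier_coeff h k * fmode k w) - h w
      = (\<Sum>k\<in>{- int N..int N}. fourier_coeff h k * fmode k w - (if k = 0 then h w else 0))"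
      by (simp add: sum_subtractf)
    then show ?thesis
      by (simp only: tele sum_telescope_int)
  qed
  moreover have "(\<lambda>N. \<kappa> (- int N - 1) - \<kappa> (int N)) \<longlonglongrightarrow> 0"
  proof -
    \<comment> \<open>Indices tending to plus infinity are estimated one unit below w, those tending
      to minus infinity one unit above. Each time the unit of height yields a factor of at most
      \<open>exp (- (2 * pi * real N))\<close>.\<close>
    obtain B where B: "B \<ge> 0" "\<And>z. z \<in> closed_segment (w - \<i>) (w - \<i> + 1) \<Longrightarrow> norm (K z) \<le> B"
      using periodic_entire_bounded_segment [OF K] by blast
    obtain C where C: "C \<ge> 0" "\<And>z. z \<in> closed_segment (w + \<i>) (w + \<i> + 1) \<Longrightarrow> norm (K z) \<le> C"
      using periodic_entire_bounded_segment [OF K] by blast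
    have lim: "(\<lambda>N. D * exp (- (2 * pi * real N))) \<longlonglongrightarrow> 0" for D :: real
      by real_asymp
    have "(\<lambda>N. \<kappa> (int N)) \<longlonglongrightarrow> 0"
    proof (rule Lim_null_comparison [OF always_eventually lim], rule allI)
      fix N show "norm (\<kappa> (int N)) \<le> B * exp (- (2 * pi * real N))"
        using norm_period_mean_fmode_le [OF K, of "w - \<i>" B "int N" w] B(2) by (simp add: \<kappa>_def)
    qed
    moreover have "(\<lambda>N. \<kappa> (- int N - 1)) \<longlonglongrightarrow> 0"
    proof (rule Lim_null_comparison [OF always_eventually lim], rule allI)
      fix N
      have "norm (\<kappa> (- int N - 1)) \<le> C * exp (2 * pi * real_of_int (- int N - 1))"
        using norm_period_mean_fmode_le [OF K, of "w + \<i>" C "- int N - 1" w] C(2) by (simp add: \<kappa>_def)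
      also have "\<dots> \<le> C * exp (- (2 * pi * real N))"
        using C(1) by (intro mult_left_mono) (auto simp: right_diff_distrib)
      finally show "norm (\<kappa> (- int N - 1)) \<le> C * exp (- (2 * pi * real N))" .
    qed
    ultimately show ?thesis
      using tendsto_diff [of "\<lambda>N. \<kappa> (- int N - 1)" 0 sequentially "\<lambda>N. \<kappa> (int N)" 0] by simp
  qed
  ultimately have "(\<lambda>N. (\<Sum>k\<in>{- int N..int N}. fourier_coeff h k * fmode k w) - h w) \<longlonglongrightarrow> 0"
    by simp
  then show ?thesis
    by (simp add: LIM_zero_iff)
qed

text \<open>The intervals from -N to N are cofinal among the finite sets of integers.\<close>

lemma has_sum_imp_int_partial_sums:
  assumes "(f has_sum s) (UNIV :: int set)"
  shows "(\<lambda>N. \<Sum>k\<in>{- int N..int N}. f k) \<longlonglongrightarrow> s"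
proof -
  have "filterlim (\<lambda>N. {- int N..int N}) (finite_subsets_at_top UNIV) sequentially"
    unfolding filterlim_finite_subsets_at_top
  proof (intro allI impI)
    fix X :: "int set"
    assume "finite X \<and> X \<subseteq> UNIV"
    then have fin: "finite ((\<lambda>k. nat \<bar>k\<bar>) ` X)" by simp
    \<comment> \<open>For empty X the maximum is unspecified, but then there is no k to
      bound.\<close>
    show "\<forall>\<^sub>F N in sequentially. finite {- int N..int N} \<and> X \<subseteq> {- int N..int N} \<and> {- int N..int N} \<subseteq> UNIV"
    proof (rule eventually_sequentiallyI [of "Max ((\<lambda>k. nat \<bar>k\<bar>) ` X)"], intro conjI subsetI)
      fix N k assume N: "Max ((\<lambda>k. nat \<bar>k\<bar>) ` X) \<le> N" and "k \<in> X"
      then have "nat \<bar>k\<bar> \<le> Max ((\<lambda>k. nat \<bar>k\<bar>) ` X)"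
        using fin by (intro Max_ge) auto
      then show "k \<in> {- int N..int N}" using N by auto
    qed auto
  qed
  then show ?thesis
    using assms unfolding has_sum_def by (rule filterlim_compose [rotated])
qed

text \<open>An unordered sum is also the limit of its symmetric partial sums, and limits are unique.
  The summability hypothesis is met below by coefficients that are Gaussian or all zero.\<close>

lemma fourier_infsum:
  assumes "h \<in> periodic_entire" "(\<lambda>k. fourier_coeff h k * fmode k w) summable_on UNIV"
  shows "(\<Sum>\<^sub>\<infinity>k. fourier_coeff h k * fmode k w) = h w"
  using has_sum_imp_int_partial_sums [OF has_sum_infsum [OF assms(2)]]
    fourier_partial_sums [OF assms(1)] by (rule LIMSEQ_unique)

text \<open>The weight is the maximum of \<open>norm (fmode k z)\<close> over the strip where
  \<open>\<bar>Im z\<bar> \<le> R\<close>, so the condition is normal convergence of the Fourier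
  series on every horizontal strip.\<close>

definition rapidly_decreasing :: "(int \<Rightarrow> complex) set" where
  "rapidly_decreasing =
     {a. \<forall>R \<ge> 0. (\<lambda>k. norm (a k) * exp (2 * pi * \<bar>of_int k\<bar> * R)) summable_on UNIV}"

definition fourier_series :: "(int \<Rightarrow> complex) \<Rightarrow> complex \<Rightarrow> complex" where
  "fourier_series a z = (\<Sum>\<^sub>\<infinity>k. a k * fmode k z)"

lemma norm_fourier_term_le:
  assumes "\<bar>Im z\<bar> \<le> R"
  shows "norm (a k * fmode k z) \<le> norm (a k) * exp (2 * pi * \<bar>of_int k\<bar> * R)"
proof -
  have "- (of_int k * Im z) \<le> \<bar>of_int k\<bar> * \<bar>Im z\<bar>"
    by (metis abs_ge_minus_self abs_mult)
  also have "\<dots> \<le> \<bar>of_int k\<bar> * R"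
    using assms by (intro mult_left_mono) auto
  finally have "- (2 * pi * of_int k * Im z) \<le> 2 * pi * \<bar>of_int k\<bar> * R"
    using mult_left_mono [of "- (of_int k * Im z)" "\<bar>of_int k\<bar> * R" "2 * pi"] by (simp add: mult.assoc)
  then show ?thesis
    by (simp add: norm_mult norm_fmode mult_left_mono)
qed

lemma fourier_series_summable:
  assumes "a \<in> rapidly_decreasing"
  shows "(\<lambda>k. a k * fmode k z) summable_on UNIV"
proof (rule abs_summable_summable, rule summable_on_comparison_test)
  show "(\<lambda>k. norm (a k) * exp (2 * pi * \<bar>of_int k\<bar> * \<bar>Im z\<bar>)) summable_on UNIV"
    using assms by (simp add: rapidly_decreasing_def)
qed (simp_all add: norm_fourier_term_le)

text \<open>Weierstrass M-test with the weights of \<open>rapidly_decreasing\<close>. For negative R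
  the disc is empty.\<close>

lemma fourier_series_uniform_limit:
  assumes "a \<in> rapidly_decreasing"
  shows "uniform_limit (cball 0 R) (\<lambda>X z. \<Sum>k\<in>X. a k * fmode k z) (fourier_series a)
    (finite_subsets_at_top UNIV)"
proof (cases "R \<ge> 0")
  case True
  show ?thesis
    unfolding fourier_series_def
  proof (rule Weierstrass_m_test_general)
    show "(\<lambda>k. norm (a k) * exp (2 * pi * \<bar>of_int k\<bar> * R)) summable_on UNIV"
      using assms True by (simp add: rapidly_decreasing_def)
    show "norm (a k * fmode k z) \<le> norm (a k) * exp (2 * pi * \<bar>of_int k\<bar> * R)"
      if "z \<in> cball 0 R" for k z
      using that abs_Im_le_cmod [of z] by (intro norm_fourier_term_le) auto
  qed
qed simp

lemma fourier_series_periodic_entire: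
  assumes "a \<in> rapidly_decreasing"
  shows "fourier_series a \<in> periodic_entire"
proof -
  have "fourier_series a holomorphic_on ball 0 R" for R
  proof (rule holomorphic_uniform_limit [OF _ fourier_series_uniform_limit [OF assms, of R]])
    show "\<forall>\<^sub>F X in finite_subsets_at_top UNIV. continuous_on (cball 0 R) (\<lambda>z. \<Sum>k\<in>X. a k * fmode k z) \<and>
      (\<lambda>z. \<Sum>k\<in>X. a k * fmode k z) holomorphic_on ball 0 R"
      by (intro always_eventually allI conjI holomorphic_on_imp_continuous_on) (intro holomorphic_intros)+
  qed auto
  then have "fourier_series a field_differentiable at z" for z
    by (rule holomorphic_on_imp_differentiable_at [where s = "ball 0 (norm z + 1)"]) auto
  then show ?thesis
    by (auto simp: periodic_entire_def holomorphic_on_def fourier_series_def fmode_add_1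
        intro: field_differentiable_at_within)
qed

lemma fourier_coeff_trig_sum:
  assumes "finite X" "j \<in> X"
  shows "fourier_coeff (\<lambda>z. \<Sum>k\<in>X. a k * fmode k z) j = a j"
proof -
  have "fourier_coeff (\<lambda>z. \<Sum>k\<in>X. a k * fmode k z) j
      = period_mean (\<lambda>z. \<Sum>k\<in>X. a k * fmode (k - j) z)"
    unfolding fourier_coeff_def
    by (simp add: sum_distrib_right mult.assoc flip: fmode_add_index)
  also have "\<dots> = (\<Sum>k\<in>X. period_mean (\<lambda>z. a k * fmode (k - j) z))"
    by (intro period_mean_sum periodic_entire_cmult periodic_entire_fmode)
  also have "\<dots> = (\<Sum>k\<in>X. if k = j then a k else 0)"
    by (intro sum.cong) (auto simp: period_mean_cmult periodic_entire_fmode period_mean_fmode)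
  finally show ?thesis using assms by simp
qed

text \<open>Finite partial sums whose index set contains j have j-th coefficient exactly
  \<open>a j\<close>. They converge uniformly on the unit disc, which contains the segment [0, 1],
  and there the modes have modulus 1, so their coefficients converge to that of the series.\<close>

lemma fourier_coeff_fourier_series:
  assumes a: "a \<in> rapidly_decreasing"
  shows "fourier_coeff (fourier_series a) j = a j"
proof -
  let ?S = "\<lambda>X z. \<Sum>k\<in>X. a k * fmode k z"
  have le: "norm (fourier_coeff (fourier_series a) j - a j) \<le> \<epsilon>" if "\<epsilon> > 0" for \<epsilon>
  proof -
    have "\<forall>\<^sub>F X in finite_subsets_at_top UNIV. finite X \<and> j \<in> X"
      unfolding eventually_finite_subsets_at_top by (rule exI [of _ "{j}"]) auto
    then have "\<forall>\<^sub>F X in finite_subsets_at_top UNIV.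
        (\<forall>z\<in>cball 0 1. dist (?S X z) (fourier_series a z) < \<epsilon>) \<and> finite X \<and> j \<in> X"
      by (rule eventually_conj [OF uniform_limitD [OF fourier_series_uniform_limit [OF a] that]])
    from eventually_happens' [OF finite_subsets_at_top_neq_bot this] obtain X
      where X: "\<And>z. z \<in> cball 0 1 \<Longrightarrow> dist (?S X z) (fourier_series a z) < \<epsilon>"
        "finite X" "j \<in> X"
      by blast
    have F: "(\<lambda>z. fourier_series a z * fmode (- j) z) \<in> periodic_entire"
      by (rule periodic_entire_mult [OF fourier_series_periodic_entire [OF a] periodic_entire_fmode])
    have S: "(\<lambda>z. ?S X z * fmode (- j) z) \<in> periodic_entire"
      by (rule periodic_entire_mult [OF periodic_entire_sum periodic_entire_fmode])
         (rule periodic_entire_cmult [OF periodic_entire_fmode])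
    have "fourier_coeff (fourier_series a) j - a j
        = fourier_coeff (fourier_series a) j - fourier_coeff (?S X) j"
      using X by (simp add: fourier_coeff_trig_sum)
    also have "\<dots> = period_mean (\<lambda>z. fourier_series a z * fmode (- j) z - ?S X z * fmode (- j) z)"
      unfolding fourier_coeff_def by (rule period_mean_diff [OF F S, symmetric])
    also have "norm \<dots> \<le> \<epsilon>"
    proof (rule norm_period_mean_le)
      show "(\<lambda>z. fourier_series a z * fmode (- j) z - ?S X z * fmode (- j) z) \<in> periodic_entire"
        by (rule periodic_entire_diff [OF F S])
      fix z :: complex assume z: "z \<in> closed_segment 0 (0 + 1)"
      have "closed_segment 0 (1 :: complex) \<subseteq> cball 0 1"
        by (rule closed_segment_subset) auto
      then have "dist (?S X z) (fourier_series a z) < \<epsilon>" "norm (fmode (- j) z) = 1"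
        using X(1) z Im_closed_segment_1 [OF z] by (auto simp: norm_fmode)
      then show "norm (fourier_series a z * fmode (- j) z - ?S X z * fmode (- j) z) \<le> \<epsilon>"
        by (simp add: norm_mult dist_norm norm_minus_commute flip: left_diff_distrib)
    qed
    finally show ?thesis .
  qed
  have "norm (fourier_coeff (fourier_series a) j - a j) \<le> 0"
  proof (rule field_le_epsilon)
    fix \<epsilon> :: real assume "0 < \<epsilon>"
    then show "norm (fourier_coeff (fourier_series a) j - a j) \<le> 0 + \<epsilon>"
      using le [of \<epsilon>] by simp
  qed
  then show ?thesis by simp
qed

section \<open>Summability of Gaussians over the integers\<close>

lemma exp_minus_abs_int_summable: "(\<lambda>k :: int. exp (- \<bar>real_of_int k\<bar>)) summable_on UNIV"
proof -
  have "summable (\<lambda>n. exp (- 1 :: real) ^ n)"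
    by (rule summable_geometric) simp
  then have *: "(\<lambda>n :: nat. exp (- real n)) summable_on UNIV"
    by (subst summable_on_UNIV_nonneg_real_iff) (auto simp flip: exp_of_nat_mult)
  have "(\<lambda>k :: int. exp (- \<bar>real_of_int k\<bar>)) summable_on range int"
    using * by (subst summable_on_reindex) (auto simp: o_def)
  moreover have "(\<lambda>k :: int. exp (- \<bar>real_of_int k\<bar>)) summable_on range (\<lambda>n. - int n)"
    using * by (subst summable_on_reindex) (auto simp: o_def inj_on_def)
  ultimately have "(\<lambda>k :: int. exp (- \<bar>real_of_int k\<bar>)) summable_on range int \<union> range (\<lambda>n. - int n)"
    by (rule summable_on_union)
  also have "range int \<union> range (\<lambda>n. - int n) = UNIV"
  proof -
    have "k \<in> range int \<union> range (\<lambda>n. - int n)" for k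
      by (cases k rule: int_cases2) auto
    then show ?thesis by blast
  qed
  finally show ?thesis .
qed

text \<open>Completing the square with \<beta> + 1 in place of \<beta> bounds the exponent by a
  constant minus the absolute value of k, which leaves a geometric series on each side.\<close>

lemma gaussian_int_summable:
  assumes "\<alpha> > 0"
  shows "(\<lambda>k :: int. exp (\<beta> * \<bar>real_of_int k\<bar> - \<alpha> * (real_of_int k)\<^sup>2)) summable_on UNIV"
proof (rule summable_on_comparison_test)
  show "(\<lambda>k :: int. exp ((\<beta> + 1)\<^sup>2 / (4 * \<alpha>)) * exp (- \<bar>real_of_int k\<bar>)) summable_on UNIV"
    by (intro summable_on_cmult_right exp_minus_abs_int_summable)
  fix k :: int
  have "0 \<le> (2 * \<alpha> * \<bar>real_of_int k\<bar> - (\<beta> + 1))\<^sup>2 / (4 * \<alpha>)"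
    using assms by simp
  also have "\<dots> = \<alpha> * \<bar>real_of_int k\<bar>\<^sup>2 - (\<beta> + 1) * \<bar>real_of_int k\<bar> + (\<beta> + 1)\<^sup>2 / (4 * \<alpha>)"
    using assms by (simp add: power2_eq_square field_simps)
  finally show "exp (\<beta> * \<bar>real_of_int k\<bar> - \<alpha> * (real_of_int k)\<^sup>2)
      \<le> exp ((\<beta> + 1)\<^sup>2 / (4 * \<alpha>)) * exp (- \<bar>real_of_int k\<bar>)"
    by (simp add: algebra_simps flip: exp_add)
qed simp

subsection \<open>Smoothness and the Heisenberg group\<close>

text \<open>The product and chain rules use this for the factors that are left
  undifferentiated.\<close>

lemma times_differentiable_SucD: "times_differentiable (Suc k) f \<Longrightarrow> times_differentiable k f"
proof (induction k arbitrary: f)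
  case 0
  then show ?case
    by (simp add: continuous_at_imp_continuous_on differentiable_imp_continuous_within)
next
  case (Suc k)
  then show ?case
    unfolding times_differentiable.simps(2) [of "Suc k"] times_differentiable.simps(2) [of k f]
    by blast
qed

text \<open>Allows explicit derivatives to stand in for \<open>frechet_derivative\<close>, by
  uniqueness of the derivative.\<close>

lemma times_differentiable_SucI:
  assumes "\<And>p. (f has_derivative f' p) (at p)" "\<And>v. times_differentiable k (\<lambda>p. f' p v)"
  shows "times_differentiable (Suc k) f"
proof -
  have "frechet_derivative f (at p) = f' p" for p
    using frechet_derivative_at [OF assms(1)] by simp
  then show ?thesis
    using assms by (auto simp: differentiable_def)
qed

lemma times_differentiable_SucE:
  assumes "times_differentiable (Suc k) f"
  obtains f' where "\<And>p. (f has_derivative f' p) (at p)" "\<And>v. times_differentiable k (\<lambda>p. f' p v)"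
proof (rule that [of "\<lambda>p. frechet_derivative f (at p)"])
  show "(f has_derivative frechet_derivative f (at p)) (at p)" for p
    using assms by (simp flip: frechet_derivative_works)
  show "times_differentiable k (\<lambda>p. frechet_derivative f (at p) v)" for v
    using assms by simp
qed

lemma times_differentiable_const: "times_differentiable k (\<lambda>p. c)"
  by (induction k arbitrary: c) auto

lemma times_differentiable_bounded_linear:
  assumes "bounded_linear L"
  shows "times_differentiable k L"
proof (cases k)
  case 0
  then show ?thesis using assms by (simp add: linear_continuous_on)
next
  case (Suc m)
  then show ?thesis
    using assms times_differentiable_SucI [OF bounded_linear_imp_has_derivative]
      times_differentiable_const by metis
qed

lemma times_differentiable_add:
  assumes "times_differentiable k f" "times_differentiable k g"
  shows "times_differentiable k (\<lambda>p. f p + g p)"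
  using assms
proof (induction k arbitrary: f g)
  case 0
  then show ?case by (simp add: continuous_on_add)
next
  case (Suc k)
  from Suc.prems(1) obtain f' where f': "\<And>p. (f has_derivative f' p) (at p)"
    "\<And>v. times_differentiable k (\<lambda>p. f' p v)" by (rule times_differentiable_SucE) blast
  from Suc.prems(2) obtain g' where g': "\<And>p. (g has_derivative g' p) (at p)"
    "\<And>v. times_differentiable k (\<lambda>p. g' p v)" by (rule times_differentiable_SucE) blast
  show ?case
    by (rule times_differentiable_SucI [OF has_derivative_add [OF f'(1) g'(1)]])
       (intro Suc.IH f' g')
qed

lemma times_differentiable_mult:
  fixes f g :: "'a::real_normed_vector \<Rightarrow> 'b::real_normed_algebra"
  assumes "times_differentiable k f" "times_differentiable k g"
  shows "times_differentiable k (\<lambda>p. f p * g p)"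
  using assms
proof (induction k arbitrary: f g)
  case 0
  then show ?case by (simp add: continuous_on_mult)
next
  case (Suc k)
  from Suc.prems(1) obtain f' where f': "\<And>p. (f has_derivative f' p) (at p)"
    "\<And>v. times_differentiable k (\<lambda>p. f' p v)" by (rule times_differentiable_SucE) blast
  from Suc.prems(2) obtain g' where g': "\<And>p. (g has_derivative g' p) (at p)"
    "\<And>v. times_differentiable k (\<lambda>p. g' p v)" by (rule times_differentiable_SucE) blast
  show ?case
    by (rule times_differentiable_SucI [OF has_derivative_mult [OF f'(1) g'(1)]])
       (intro times_differentiable_add Suc.IH f' g' times_differentiable_SucD [OF Suc.prems(1)]
          times_differentiable_SucD [OF Suc.prems(2)])
qed

text \<open>The chain rule produces \<open>deriv H\<close>, which is again entire, so the induction
  runs over all entire H at once.\<close>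

lemma times_differentiable_holomorphic:
  assumes "H holomorphic_on UNIV" "times_differentiable k g"
  shows "times_differentiable k (\<lambda>p. H (g p))"
  using assms
proof (induction k arbitrary: H)
  case 0
  then show ?case
    by (simp add: continuous_on_compose2 [OF holomorphic_on_imp_continuous_on])
next
  case (Suc k)
  from Suc.prems(2) obtain g' where g': "\<And>p. (g has_derivative g' p) (at p)"
    "\<And>v. times_differentiable k (\<lambda>p. g' p v)" by (rule times_differentiable_SucE) blast
  have "(H has_derivative (\<lambda>v. deriv H (g p) * v)) (at (g p))" for p
    using holomorphic_derivI [OF Suc.prems(1), of "g p"] by (simp add: has_field_derivative_def)
  then have "((\<lambda>p. H (g p)) has_derivative (\<lambda>v. deriv H (g p) * g' p v)) (at p)" for p
    using has_derivative_compose [OF g'(1)] by fast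
  then show ?case
    by (rule times_differentiable_SucI)
       (rule times_differentiable_mult [OF Suc.IH [OF holomorphic_deriv [OF Suc.prems(1) open_UNIV]
            times_differentiable_SucD [OF Suc.prems(2)]] g'(2)])
qed

lemma smooth_has_derivative:
  assumes "smooth f"
  shows "(f has_derivative frechet_derivative f (at p)) (at p)"
proof -
  have "times_differentiable (Suc 0) f"
    using assms unfolding smooth_def by blast
  then show ?thesis
    by (simp add: frechet_derivative_works)
qed

text \<open>A coordinate-free form of the exponent: \<open>Im (fst p) / Im \<tau>\<close> is the
  coordinate y, and y z = x y + \<tau> y^2.\<close>

definition heis_exponent :: "complex \<Rightarrow> int \<Rightarrow> complex \<times> real \<Rightarrow> complex" where
  "heis_exponent \<tau> n p = of_real pi * \<i> * of_int n *
     (of_real (snd p / Im \<tau>) + of_real (Im (fst p) / Im \<tau>) * fst p)"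

definition heis_lift :: "complex \<Rightarrow> int \<Rightarrow> (complex \<Rightarrow> complex) \<Rightarrow> complex \<times> real \<Rightarrow> complex" where
  "heis_lift \<tau> n H p = exp (heis_exponent \<tau> n p) * H (fst p)"

text \<open>These are the theta functions of degree n for the lattice spanned by 1 and
  \<tau>.\<close>

definition theta_space :: "complex \<Rightarrow> int \<Rightarrow> (complex \<Rightarrow> complex) set" where
  "theta_space \<tau> n = {H \<in> periodic_entire.
     \<forall>z. exp (of_real pi * \<i> * of_int n * (2 * z + \<tau>)) * H (z + \<tau>) = H z}"

lemma smooth_heis_lift:
  assumes "H holomorphic_on UNIV"
  shows "smooth (heis_lift \<tau> n H)"
proof -
  have "bounded_linear (\<lambda>p :: complex \<times> real. complex_of_real (snd p / Im \<tau>))"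
    "bounded_linear (\<lambda>p :: complex \<times> real. complex_of_real (Im (fst p) / Im \<tau>))"
    by (auto intro!: linearI simp: linear_conv_bounded_linear [symmetric] add_divide_distrib
        scaleR_conv_of_real)
  then have "times_differentiable k (heis_exponent \<tau> n)" for k
    unfolding heis_exponent_def
    by (intro times_differentiable_mult times_differentiable_add times_differentiable_const)
       (auto intro: times_differentiable_bounded_linear bounded_linear_fst)
  then have "times_differentiable k (\<lambda>p. exp (heis_exponent \<tau> n p))" for k
    by (rule times_differentiable_holomorphic [OF holomorphic_on_exp])
  moreover have "times_differentiable k (\<lambda>p. H (fst p))" for k
    by (rule times_differentiable_holomorphic [OF assms
          times_differentiable_bounded_linear [OF bounded_linear_fst]])
  ultimately show ?thesis
    unfolding smooth_def heis_lift_def by (intro allI times_differentiable_mult)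
qed

lemma heis_exponent_has_derivative:
  assumes "Im \<tau> \<noteq> 0"
  shows "(heis_exponent \<tau> n has_derivative (\<lambda>v. of_real pi * \<i> * of_int n *
     (of_real (snd v / Im \<tau>) + of_real (Im (fst v) / Im \<tau>) * fst p
        + of_real (Im (fst p) / Im \<tau>) * fst v))) (at p)"
  unfolding heis_exponent_def using assms
  by (auto intro!: derivative_eq_intros simp: algebra_simps add_divide_distrib)

text \<open>The group law adds - Im z to t, which cancels the growth of y z by y = Im z / Im
  \<tau>.\<close>

lemma heis_exponent_1:
  assumes "Im \<tau> \<noteq> 0"
  shows "heis_exponent \<tau> n (p \<otimes>\<^bsub>heisenberg\<^esub> (1, 0)) = heis_exponent \<tau> n p"
  using assms
  by (cases p) (simp add: heis_exponent_def heisenberg_def field_simps)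

text \<open>Here y grows by 1 and the group law adds x to t / Im \<tau>, and (y + 1)(z + \<tau>) - y
  z + x = 2 z + \<tau>.\<close>

lemma heis_exponent_tau:
  assumes "Im \<tau> \<noteq> 0"
  shows "heis_exponent \<tau> n (p \<otimes>\<^bsub>heisenberg\<^esub> (\<tau>, 0))
    = heis_exponent \<tau> n p + of_real pi * \<i> * of_int n * (2 * fst p + \<tau>)"
proof (cases p)
  case (Pair z t)
  have "complex_of_real ((t + Im (cnj z * \<tau>)) / Im \<tau>) + of_real (Im (z + \<tau>) / Im \<tau>) * (z + \<tau>)
      = of_real (t / Im \<tau>) + of_real (Im z / Im \<tau>) * z + (2 * z + \<tau>)"
    using assms by (simp add: complex_eq_iff field_simps)
  then show ?thesis
    unfolding Pair heis_exponent_def heisenberg_def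
    by (simp only: monoid.simps fst_conv snd_conv prod.case add_0_right) (simp only: distrib_left)
qed

text \<open>The point p varies in the induction: inverses are treated at the base point p h^{-1},
  and products move p to p h1.\<close>

lemma invariant_under_generate:
  assumes "group G" "S \<subseteq> carrier G"
    and "\<And>p g. p \<in> carrier G \<Longrightarrow> g \<in> S \<Longrightarrow> f (p \<otimes>\<^bsub>G\<^esub> g) = f p"
    and "g \<in> generate G S" "p \<in> carrier G"
  shows "f (p \<otimes>\<^bsub>G\<^esub> g) = f p"
  using assms(4,5)
proof (induction g arbitrary: p rule: generate.induct)
  case one
  then show ?case using assms(1) by (simp add: group.is_monoid)
next
  case (incl h)
  then show ?case using assms(3) by blast
next
  case (inv h)
  interpret group G by fact
  have h: "h \<in> carrier G" using inv assms(2) by blast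
  have "f (p \<otimes>\<^bsub>G\<^esub> inv\<^bsub>G\<^esub> h) = f (p \<otimes>\<^bsub>G\<^esub> inv\<^bsub>G\<^esub> h \<otimes>\<^bsub>G\<^esub> h)"
    using assms(3) [OF _ inv(1), of "p \<otimes>\<^bsub>G\<^esub> inv\<^bsub>G\<^esub> h"] inv(2) h by simp
  also have "p \<otimes>\<^bsub>G\<^esub> inv\<^bsub>G\<^esub> h \<otimes>\<^bsub>G\<^esub> h = p"
    using inv(2) h by (simp add: m_assoc)
  finally show ?case .
next
  case (eng h1 h2)
  interpret group G by fact
  have "h1 \<in> carrier G" "h2 \<in> carrier G"
    using eng.hyps generate_in_carrier assms(2) by blast+
  then show ?case
    using eng.IH(1) [OF eng.prems] eng.IH(2) [of "p \<otimes>\<^bsub>G\<^esub> h1"] eng.prems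
    by (simp add: m_assoc)
qed

lemma smooth_M3_iff:
  "f \<in> smooth_M3 \<tau> \<longleftrightarrow> smooth f \<and> (\<forall>p. f (p \<otimes>\<^bsub>heisenberg\<^esub> (1, 0)) = f p) \<and>
    (\<forall>p. f (p \<otimes>\<^bsub>heisenberg\<^esub> (\<tau>, 0)) = f p)"
proof
  assume "f \<in> smooth_M3 \<tau>"
  moreover have "(1, 0) \<in> heisenberg_int \<tau>" "(\<tau>, 0) \<in> heisenberg_int \<tau>"
    unfolding heisenberg_int_def by (auto intro: generate.incl)
  ultimately show "smooth f \<and> (\<forall>p. f (p \<otimes>\<^bsub>heisenberg\<^esub> (1, 0)) = f p) \<and>
      (\<forall>p. f (p \<otimes>\<^bsub>heisenberg\<^esub> (\<tau>, 0)) = f p)"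
    by (auto simp: smooth_M3_def)
next
  assume *: "smooth f \<and> (\<forall>p. f (p \<otimes>\<^bsub>heisenberg\<^esub> (1, 0)) = f p) \<and>
      (\<forall>p. f (p \<otimes>\<^bsub>heisenberg\<^esub> (\<tau>, 0)) = f p)"
  have "f (p \<otimes>\<^bsub>heisenberg\<^esub> g) = f p" if "g \<in> heisenberg_int \<tau>" for p g
    by (rule invariant_under_generate [OF group_heisenberg _ _ that [unfolded heisenberg_int_def]])
       (use * in \<open>auto simp: heisenberg_def\<close>)
  with * show "f \<in> smooth_M3 \<tau>"
    by (simp add: smooth_M3_def)
qed

text \<open>The exponential factor never vanishes, so cancelling it turns invariance under each
  generator into one of the two functional equations.\<close>

lemma heis_lift_in_smooth_M3_iff:
  assumes "Im \<tau> \<noteq> 0" "H holomorphic_on UNIV"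
  shows "heis_lift \<tau> n H \<in> smooth_M3 \<tau> \<longleftrightarrow> H \<in> theta_space \<tau> n"
proof -
  have [simp]: "fst (p \<otimes>\<^bsub>heisenberg\<^esub> q) = fst p + fst q" for p q
    by (cases p; cases q) (simp add: heisenberg_def)
  show ?thesis
    using assms
    by (simp add: smooth_M3_iff smooth_heis_lift heis_lift_def heis_exponent_1 heis_exponent_tau
        theta_space_def periodic_entire_def exp_add mult.assoc)
qed

section \<open>The differential operators on lifted functions\<close>

lemma d_t_eq: "(f has_derivative D) (at p) \<Longrightarrow> d_t f p = D (0, 1)"
  by (simp add: d_t_def frechet_derivative_at [symmetric])

lemma d_zbar_eq: "(f has_derivative D) (at p) \<Longrightarrow> d_zbar f p = (D (1, 0) + \<i> * D (\<i>, 0)) / 2"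
  by (simp add: d_zbar_def frechet_derivative_at [symmetric])

text \<open>In the derivative by the conjugate variable only the factor Im z / Im \<tau> of the
  exponent is seen, since everything else is holomorphic in z. It contributes i z / 2 times the
  t-derivative, which is exactly what \<open>q_op\<close> subtracts.\<close>

lemma heis_lift_operators:
  assumes "Im \<tau> \<noteq> 0" "H holomorphic_on UNIV"
  shows "q_op \<tau> (heis_lift \<tau> n H) = (\<lambda>p. 0)"
    and "t_op \<tau> (heis_lift \<tau> n H) = (\<lambda>p. of_int n * heis_lift \<tau> n H p)"
proof -
  let ?C = "of_real pi * \<i> * of_int n"
  let ?E = "\<lambda>p v. ?C * (of_real (snd v / Im \<tau>) + of_real (Im (fst v) / Im \<tau>) * fst p
        + of_real (Im (fst p) / Im \<tau>) * fst v)"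
  have D: "(heis_lift \<tau> n H has_derivative (\<lambda>v. exp (heis_exponent \<tau> n p) *
     (?E p v * H (fst p) + deriv H (fst p) * fst v))) (at p)" for p
  proof -
    have "(H has_derivative (\<lambda>v. deriv H (fst p) * v)) (at (fst p))"
      using holomorphic_derivI [OF assms(2), of "fst p"] by (simp add: has_field_derivative_def)
    from has_derivative_compose [OF has_derivative_fst [OF has_derivative_ident] this]
    have "((\<lambda>p. H (fst p)) has_derivative (\<lambda>v. deriv H (fst p) * fst v)) (at p)" by simp
    moreover have "((\<lambda>p. exp (heis_exponent \<tau> n p)) has_derivative
        (\<lambda>v. exp (heis_exponent \<tau> n p) * ?E p v)) (at p)"
      using has_derivative_compose [OF heis_exponent_has_derivative [OF assms(1)]
          DERIV_exp [unfolded has_field_derivative_def]] by fast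
    ultimately show ?thesis
      unfolding heis_lift_def by (rule has_derivative_eq_rhs [OF has_derivative_mult [rotated]])
        (simp add: fun_eq_iff algebra_simps)
  qed
  have t: "d_t (heis_lift \<tau> n H) p = ?C / Im \<tau> * heis_lift \<tau> n H p" for p
    using d_t_eq [OF D] by (simp add: heis_lift_def algebra_simps)
  have zbar: "d_zbar (heis_lift \<tau> n H) p = \<i> * fst p / 2 * (?C / Im \<tau> * heis_lift \<tau> n H p)" for p
    using d_zbar_eq [OF D] by (simp add: heis_lift_def algebra_simps)
  show "q_op \<tau> (heis_lift \<tau> n H) = (\<lambda>p. 0)"
    by (auto simp: q_op_def t zbar)
  show "t_op \<tau> (heis_lift \<tau> n H) = (\<lambda>p. of_int n * heis_lift \<tau> n H p)"
    using assms(1) by (auto simp: t_op_def t)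
qed

text \<open>Divide f by the exponential. The weight equation makes the quotient G independent of t,
  and the equation for \<open>q_op\<close> then becomes the Cauchy-Riemann equation for G as a
  function of z.\<close>

lemma heis_lift_of_hol_weight:
  assumes "Im \<tau> > 0" and f: "f \<in> A_hol \<tau>" "f \<in> A_weight \<tau> n"
  obtains H where "H holomorphic_on UNIV" "f = heis_lift \<tau> n H"
proof -
  let ?C = "of_real pi * \<i> * of_int n"
  let ?E = "\<lambda>p v. ?C * (of_real (snd v / Im \<tau>) + of_real (Im (fst v) / Im \<tau>) * fst p
        + of_real (Im (fst p) / Im \<tau>) * fst v)"
  define F where "F p = frechet_derivative f (at p)" for p
  define G where "G p = exp (- heis_exponent \<tau> n p) * f p" for p
  have "smooth f"
    using f(1) by (simp add: A_hol_def smooth_M3_def)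
  then have F: "(f has_derivative F p) (at p)" for p
    unfolding F_def by (rule smooth_has_derivative)
  have "of_real (Im \<tau>) / (of_real pi * \<i>) * F p (0, 1) = of_int n * f p" for p
  proof -
    have "t_op \<tau> f = (\<lambda>p. of_int n * f p)"
      using f(2) by (simp add: A_weight_def)
    from fun_cong [OF this, of p] show ?thesis
      by (simp add: t_op_def d_t_def F_def)
  qed
  then have Ft: "F p (0, 1) = ?C / Im \<tau> * f p" for p
    using assms(1) by (simp add: field_simps)
  have "(F p (1, 0) + \<i> * F p (\<i>, 0)) / 2 - \<i> * fst p / 2 * F p (0, 1) = 0" for p
  proof -
    have "q_op \<tau> f (fst p, snd p) = 0"
      using f(1) by (simp add: A_hol_def)
    then show ?thesis
      using assms(1) by (cases p) (simp add: q_op_def d_t_def d_zbar_def F_def)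
  qed
  then have "F p (1, 0) + \<i> * F p (\<i>, 0) = \<i> * fst p * F p (0, 1)" for p
    by (simp only: times_divide_eq_left flip: diff_divide_distrib) simp
  then have Fz: "F p (1, 0) + \<i> * F p (\<i>, 0) = \<i> * fst p * (?C / Im \<tau> * f p)" for p
    by (simp only: Ft)
  have G: "(G has_derivative (\<lambda>v. exp (- heis_exponent \<tau> n p) * (F p v - ?E p v * f p))) (at p)" for p
  proof -
    have "((\<lambda>p. exp (- heis_exponent \<tau> n p)) has_derivative
        (\<lambda>v. exp (- heis_exponent \<tau> n p) * - ?E p v)) (at p)"
      by (rule has_derivative_compose [OF has_derivative_minus [OF heis_exponent_has_derivative]
          DERIV_exp [unfolded has_field_derivative_def]]) (use assms(1) in simp)
    then show ?thesis
      unfolding G_def by (rule has_derivative_eq_rhs [OF has_derivative_mult [OF _ F]])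
        (simp add: fun_eq_iff algebra_simps)
  qed
  have G_indep: "G (z, t) = G (z, 0)" for z t
  proof -
    have "((\<lambda>t. G (z, t)) has_derivative (\<lambda>u. 0)) (at t)" for t
    proof -
      have "((\<lambda>t. (z, t)) has_derivative (\<lambda>u. (0, u))) (at t)"
        by (auto intro!: derivative_eq_intros)
      from has_derivative_compose [OF this G]
      have D: "((\<lambda>t. G (z, t)) has_derivative (\<lambda>u. exp (- heis_exponent \<tau> n (z, t)) *
          (F (z, t) (0, u) - ?E (z, t) (0, u) * f (z, t)))) (at t)" .
      have "F (z, t) (0, u) = of_real u * F (z, t) (0, 1)" for u
        using linear_cmul [OF has_derivative_linear [OF F], of "(z, t)" u "(0, 1)"]
        by (simp add: scaleR_conv_of_real)
      then have "F (z, t) (0, u) - ?E (z, t) (0, u) * f (z, t) = 0" for u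
        by (simp add: Ft field_simps)
      with D show ?thesis by simp
    qed
    then have "\<exists>c. \<forall>t\<in>UNIV. G (z, t) = c"
      by (intro has_derivative_zero_constant) auto
    then show ?thesis by force
  qed
  define H where "H z = G (z, 0)" for z
  have "H field_differentiable at z" for z
  proof -
    let ?p = "(z, 0 :: real)"
    define D where "D v = exp (- heis_exponent \<tau> n ?p) * (F ?p (v, 0) - ?E ?p (v, 0) * f ?p)" for v
    have "((\<lambda>z. (z, 0 :: real)) has_derivative (\<lambda>v. (v, 0))) (at z)"
      by (auto intro!: derivative_eq_intros)
    from has_derivative_compose [OF this G]
    have D: "(H has_derivative D) (at z)"
      unfolding H_def D_def .
    \<comment> \<open>The left side is twice the derivative of H by the conjugate variable; the
      contributions of f and of the exponent cancel by \<open>Fz\<close>.\<close>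
    have "D 1 + \<i> * D \<i> = exp (- heis_exponent \<tau> n ?p) *
        ((F ?p (1, 0) + \<i> * F ?p (\<i>, 0)) - (?E ?p (1, 0) + \<i> * ?E ?p (\<i>, 0)) * f ?p)"
      by (simp add: D_def algebra_simps)
    also have "\<dots> = 0"
      by (simp add: Fz algebra_simps)
    finally have Di: "D \<i> = \<i> * D 1"
      by (simp add: add_eq_0_iff algebra_simps) (metis complex_i_mult_minus minus_minus)
    \<comment> \<open>A real-linear map with D \<i> = \<i> D 1 is complex-linear.\<close>
    have "D v = D 1 * v" for v
    proof -
      have "D v = D (Re v *\<^sub>R 1 + Im v *\<^sub>R \<i>)"
        by (rule arg_cong [where f = D]) (simp add: complex_eq_iff)
      also have "\<dots> = Re v *\<^sub>R D 1 + Im v *\<^sub>R D \<i>"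
        using has_derivative_linear [OF D] by (simp only: linear_add linear_cmul)
      also have "\<dots> = D 1 * v"
        unfolding Di by (simp add: complex_eq_iff algebra_simps)
      finally show ?thesis .
    qed
    then have "D = (*) (D 1)" by blast
    then show ?thesis
      using D by (metis field_differentiable_def has_field_derivative_def)
  qed
  then have "H holomorphic_on UNIV"
    by (simp add: holomorphic_on_def field_differentiable_at_within)
  moreover have "f = heis_lift \<tau> n H"
  proof
    fix p :: "complex \<times> real"
    have "H (fst p) = G p"
      using G_indep [of "fst p" "snd p"] by (simp add: H_def)
    then show "f p = heis_lift \<tau> n H p"
      by (simp add: heis_lift_def G_def exp_minus)
  qed
  ultimately show ?thesis using that by blast
qed

lemma hol_weight_eq:
  assumes "Im \<tau> > 0"
  shows "A_hol \<tau> \<inter> A_weight \<tau> n = heis_lift \<tau> n ` theta_space \<tau> n"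
proof (intro equalityI subsetI)
  fix f assume f: "f \<in> A_hol \<tau> \<inter> A_weight \<tau> n"
  then obtain H where H: "H holomorphic_on UNIV" "f = heis_lift \<tau> n H"
    using heis_lift_of_hol_weight [OF assms] by (metis IntD1 IntD2)
  have "heis_lift \<tau> n H \<in> smooth_M3 \<tau>"
    using f by (simp add: A_hol_def H(2))
  then show "f \<in> heis_lift \<tau> n ` theta_space \<tau> n"
    using assms H by (simp add: heis_lift_in_smooth_M3_iff)
next
  fix f assume "f \<in> heis_lift \<tau> n ` theta_space \<tau> n"
  then obtain H where H: "H \<in> theta_space \<tau> n" "f = heis_lift \<tau> n H"
    by blast
  then have "H holomorphic_on UNIV"
    by (simp add: theta_space_def periodic_entire_def)
  then show "f \<in> A_hol \<tau> \<inter> A_weight \<tau> n"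
    using assms H by (simp add: A_hol_def A_weight_def heis_lift_in_smooth_M3_iff heis_lift_operators)
qed

lemma inj_heis_lift: "inj (heis_lift \<tau> n)"
proof (rule injI, rule ext)
  fix H H' z assume "heis_lift \<tau> n H = heis_lift \<tau> n H'"
  from fun_cong [OF this, of "(z, 0)"] show "H z = H' z"
    by (simp add: heis_lift_def)
qed

subsection \<open>Theta functions\<close>

definition gaussian_coeffs :: "complex \<Rightarrow> int \<Rightarrow> (int \<Rightarrow> complex) \<Rightarrow> int \<Rightarrow> complex" where
  "gaussian_coeffs \<tau> n c k = c k * q_pow \<tau> (of_int (k ^ 2) / of_int n)"

section \<open>Powers of q and periodic coefficient sequences\<close>

lemma q_pow_add: "q_pow \<tau> (r + s) = q_pow \<tau> r * q_pow \<tau> s"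
  by (simp add: q_pow_def distrib_left exp_add)

lemma q_pow_nonzero [simp]: "q_pow \<tau> s \<noteq> 0"
  by (simp add: q_pow_def)

lemma norm_q_pow: "norm (q_pow \<tau> s) = exp (- (pi * Im \<tau> * s))"
  by (simp add: q_pow_def)

lemma q_pow_int: "q_pow \<tau> (of_int (2 * k + n)) = fmode k \<tau> * exp (of_real pi * \<i> * of_int n * \<tau>)"
  by (simp add: q_pow_def fmode_def algebra_simps flip: exp_add)

text \<open>Since (k + n)^2 / n = k^2 / n + 2 k + n, dividing by these powers turns the recursion
  for Fourier coefficients into periodicity.\<close>

lemma q_pow_square_shift:
  assumes "n \<noteq> 0"
  shows "q_pow \<tau> (of_int ((k + n) ^ 2) / of_int n)
    = q_pow \<tau> (of_int (k ^ 2) / of_int n) * q_pow \<tau> (of_int (2 * k + n))"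
proof -
  have "of_int ((k + n) ^ 2) / of_int n = of_int (k ^ 2) / of_int n + real_of_int (2 * k + n)"
    using assms by (simp add: field_simps power2_eq_square)
  then show ?thesis by (simp only: q_pow_add)
qed

lemma periodic_int_add_mult:
  assumes "c \<in> periodic_int n"
  shows "c (k + of_nat m * n) = c k"
proof (induction m)
  case (Suc m)
  have "c (k + of_nat m * n + n) = c (k + of_nat m * n)"
    using assms unfolding periodic_int_def by blast
  with Suc show ?case by (simp add: algebra_simps)
qed simp

lemma periodic_int_mod:
  assumes "c \<in> periodic_int n" "n > 0"
  shows "c (k mod n) = c k"
\<comment> \<open>\<open>periodic_int_add_mult\<close> only adds natural multiples of n, so for a
  negative quotient one starts from k and climbs to \<open>k mod n\<close>.\<close>
proof (cases "k div n \<ge> 0")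
  case True
  then show ?thesis
    using periodic_int_add_mult [OF assms(1), of "k mod n" "nat (k div n)"] by simp
next
  case False
  have "k + of_nat (nat (- (k div n))) * n = k mod n"
    using False by (simp add: minus_div_mult_eq_mod [symmetric])
  then show ?thesis
    using periodic_int_add_mult [OF assms(1), of k "nat (- (k div n))"] by simp
qed

lemma periodic_int_bounded:
  assumes "c \<in> periodic_int n" "n > 0"
  obtains B where "\<And>k. norm (c k) \<le> B"
proof -
  have "norm (c k) \<le> Max ((\<lambda>k. norm (c k)) ` {0..<n})" for k
    using assms by (subst periodic_int_mod [symmetric, of c n k]) (auto intro!: Max_ge)
  then show ?thesis using that by blast
qed

text \<open>As n and Im \<tau> are positive, the power of q has modulus exp(- pi Im \<tau> k^2 / n),
  and periodicity bounds c.\<close>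

lemma gaussian_coeffs_rapidly_decreasing:
  assumes "Im \<tau> > 0" "n > 0" "c \<in> periodic_int n"
  shows "gaussian_coeffs \<tau> n c \<in> rapidly_decreasing"
proof -
  obtain B where B: "\<And>k. norm (c k) \<le> B"
    using periodic_int_bounded assms(2,3) by blast
  have "(\<lambda>k. norm (gaussian_coeffs \<tau> n c k) * exp (2 * pi * \<bar>of_int k\<bar> * R)) summable_on UNIV" for R
  proof (rule summable_on_comparison_test)
    show "(\<lambda>k :: int. B * exp (2 * pi * R * \<bar>real_of_int k\<bar>
        - pi * Im \<tau> / of_int n * (real_of_int k)\<^sup>2)) summable_on UNIV"
      using assms by (intro summable_on_cmult_right gaussian_int_summable) simp
    show "norm (gaussian_coeffs \<tau> n c k) * exp (2 * pi * \<bar>of_int k\<bar> * R)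
        \<le> B * exp (2 * pi * R * \<bar>real_of_int k\<bar> - pi * Im \<tau> / of_int n * (real_of_int k)\<^sup>2)" for k
    proof -
      have "norm (gaussian_coeffs \<tau> n c k) * exp (2 * pi * \<bar>of_int k\<bar> * R)
        = norm (c k) * exp (2 * pi * R * \<bar>real_of_int k\<bar> - pi * Im \<tau> / of_int n * (real_of_int k)\<^sup>2)"
        by (simp add: gaussian_coeffs_def norm_mult norm_q_pow algebra_simps flip: exp_add)
      also have "\<dots> \<le> B * exp (2 * pi * R * \<bar>real_of_int k\<bar> - pi * Im \<tau> / of_int n * (real_of_int k)\<^sup>2)"
        by (intro mult_right_mono B) simp
      finally show ?thesis .
    qed
  qed simp
  then show ?thesis
    by (simp add: rapidly_decreasing_def)
qed

text \<open>Shifting by \<tau> and multiplying by the theta factor carries the term of index k to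
  that of index k + n, so the sum is merely reindexed.\<close>

lemma theta_series_in_theta_space:
  assumes "Im \<tau> > 0" "n > 0" "c \<in> periodic_int n"
  shows "fourier_series (gaussian_coeffs \<tau> n c) \<in> theta_space \<tau> n"
proof -
  let ?a = "gaussian_coeffs \<tau> n c"
  have step: "exp (of_real pi * \<i> * of_int n * (2 * z + \<tau>)) * (?a k * fmode k (z + \<tau>))
      = ?a (k + n) * fmode (k + n) z" for k z
  proof -
    have "c (k + n) = c k"
      using assms(3) by (simp add: periodic_int_def)
    then have "?a (k + n) = ?a k * (fmode k \<tau> * exp (of_real pi * \<i> * of_int n * \<tau>))"
      using assms(2) by (simp only: gaussian_coeffs_def q_pow_square_shift q_pow_int) simp
    moreover have "exp (of_real pi * \<i> * of_int n * (2 * z + \<tau>))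
        = fmode n z * exp (of_real pi * \<i> * of_int n * \<tau>)"
      by (simp add: fmode_def algebra_simps flip: exp_add)
    ultimately show ?thesis
      by (simp add: fmode_add fmode_add_index)
  qed
  have "exp (of_real pi * \<i> * of_int n * (2 * z + \<tau>)) * fourier_series ?a (z + \<tau>)
      = fourier_series ?a z" for z
  proof -
    have "exp (of_real pi * \<i> * of_int n * (2 * z + \<tau>)) * fourier_series ?a (z + \<tau>)
      = (\<Sum>\<^sub>\<infinity>k. ?a (k + n) * fmode (k + n) z)"
      unfolding fourier_series_def step [symmetric]
      by (rule infsum_cmult_right [symmetric])
         (intro fourier_series_summable gaussian_coeffs_rapidly_decreasing assms)
    also have "\<dots> = fourier_series ?a z"
      unfolding fourier_series_def
      by (rule infsum_reindex_bij_betw) (rule bij_plus_right)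
    finally show ?thesis .
  qed
  then show ?thesis
    by (simp add: theta_space_def fourier_series_periodic_entire
        gaussian_coeffs_rapidly_decreasing assms)
qed

text \<open>The functional equation rewrites the integrand for k + n as a constant times the
  integrand for k evaluated at z + \<tau>, and means are invariant under that shift.\<close>

lemma fourier_coeff_theta_shift:
  assumes "H \<in> theta_space \<tau> n"
  shows "fourier_coeff H (k + n) = fourier_coeff H k * q_pow \<tau> (of_int (2 * k + n))"
proof -
  have H: "H \<in> periodic_entire"
    using assms by (simp add: theta_space_def)
  let ?h = "\<lambda>z. H z * fmode (- k) z"
  have h: "?h \<in> periodic_entire"
    by (rule periodic_entire_mult [OF H periodic_entire_fmode])
  have "H z * fmode (- (k + n)) z = q_pow \<tau> (of_int (2 * k + n)) * ?h (z + \<tau>)" for z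
  proof -
    have "H z = exp (of_real pi * \<i> * of_int n * (2 * z + \<tau>)) * H (z + \<tau>)"
      using assms by (simp add: theta_space_def)
    moreover have "exp (of_real pi * \<i> * of_int n * (2 * z + \<tau>)) * fmode (- (k + n)) z
        = q_pow \<tau> (of_int (2 * k + n)) * fmode (- k) (z + \<tau>)"
      by (simp add: fmode_def q_pow_def algebra_simps flip: exp_add)
    ultimately show ?thesis by (metis (no_types, lifting) mult.assoc mult.commute)
  qed
  then have "fourier_coeff H (k + n)
      = period_mean (\<lambda>z. q_pow \<tau> (of_int (2 * k + n)) * ?h (z + \<tau>))"
    unfolding fourier_coeff_def by presburger
  also have "\<dots> = q_pow \<tau> (of_int (2 * k + n)) * period_mean (\<lambda>z. ?h (z + \<tau>))"
    by (rule period_mean_cmult [OF periodic_entire_shift [OF h]])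
  also have "period_mean (\<lambda>z. ?h (z + \<tau>)) = fourier_coeff H k"
    unfolding fourier_coeff_def by (rule period_mean_shift [OF h])
  finally show ?thesis by (simp add: mult.commute)
qed

lemma fourier_coeff_theta:
  assumes "H \<in> theta_space \<tau> n" "n \<noteq> 0"
  obtains c where "c \<in> periodic_int n" "fourier_coeff H = gaussian_coeffs \<tau> n c"
proof -
  define c where "c k = fourier_coeff H k / q_pow \<tau> (of_int (k ^ 2) / of_int n)" for k
  have "c (k + n) = c k" for k
    by (simp only: c_def fourier_coeff_theta_shift [OF assms(1)] q_pow_square_shift [OF assms(2)])
      simp
  moreover have "fourier_coeff H = gaussian_coeffs \<tau> n c"
    by (simp add: fun_eq_iff gaussian_coeffs_def c_def)
  ultimately show ?thesis using that [of c] by (simp add: periodic_int_def)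
qed

text \<open>Injectivity: the series determines its coefficients. Surjectivity: the Fourier
  coefficients of a theta function are Gaussian, hence summable against the modes, so its expansion
  converges to it.\<close>

lemma theta_series_bij_betw:
  assumes "Im \<tau> > 0" "n > 0"
  shows "bij_betw (\<lambda>c. fourier_series (gaussian_coeffs \<tau> n c)) (periodic_int n) (theta_space \<tau> n)"
proof (rule bij_betw_imageI)
  show "inj_on (\<lambda>c. fourier_series (gaussian_coeffs \<tau> n c)) (periodic_int n)"
  proof (rule inj_onI, rule ext)
    fix c c' k
    assume c: "c \<in> periodic_int n" "c' \<in> periodic_int n"
      "fourier_series (gaussian_coeffs \<tau> n c) = fourier_series (gaussian_coeffs \<tau> n c')"
    then have "gaussian_coeffs \<tau> n c k = gaussian_coeffs \<tau> n c' k"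
      using fourier_coeff_fourier_series gaussian_coeffs_rapidly_decreasing [OF assms] by metis
    then show "c k = c' k" by (simp add: gaussian_coeffs_def)
  qed
  show "(\<lambda>c. fourier_series (gaussian_coeffs \<tau> n c)) ` periodic_int n = theta_space \<tau> n"
  proof (intro equalityI subsetI)
    fix H assume H: "H \<in> theta_space \<tau> n"
    obtain c where c: "c \<in> periodic_int n" "fourier_coeff H = gaussian_coeffs \<tau> n c"
      using fourier_coeff_theta [OF H] assms(2) by auto
    have "H = fourier_series (gaussian_coeffs \<tau> n c)"
    proof
      fix z
      have "(\<Sum>\<^sub>\<infinity>k. fourier_coeff H k * fmode k z) = H z"
        by (rule fourier_infsum) (use H c assms in \<open>auto simp: theta_space_def
          intro: fourier_series_summable gaussian_coeffs_rapidly_decreasing\<close>)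
      then show "H z = fourier_series (gaussian_coeffs \<tau> n c) z"
        by (simp add: fourier_series_def c(2))
    qed
    then show "H \<in> (\<lambda>c. fourier_series (gaussian_coeffs \<tau> n c)) ` periodic_int n"
      using c(1) by blast
  qed (use theta_series_in_theta_space [OF assms] in blast)
qed

lemma fourier_coeff_bounded:
  assumes "h \<in> periodic_entire"
  obtains B where "\<And>k. norm (fourier_coeff h k) \<le> B"
proof -
  obtain B where "\<And>z. z \<in> closed_segment 0 (0 + 1) \<Longrightarrow> norm (h z) \<le> B"
    using periodic_entire_bounded_segment [OF assms] by blast
  then have "norm (fourier_coeff h k) \<le> B" for k
    using norm_period_mean_fmode_le [OF assms, of 0 B k 0] by (simp add: fourier_coeff_def)
  then show ?thesis using that by blast
qed

lemma theta_space_negative: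
  assumes "Im \<tau> > 0" "n < 0"
  shows "theta_space \<tau> n = {\<lambda>z. 0}"
proof (intro equalityI subsetI)
  fix H assume H: "H \<in> theta_space \<tau> n"
  then have hp: "H \<in> periodic_entire" by (simp add: theta_space_def)
  obtain c where c: "c \<in> periodic_int n" "fourier_coeff H = gaussian_coeffs \<tau> n c"
    using fourier_coeff_theta [OF H] assms(2) by auto
  obtain B where B: "\<And>k. norm (fourier_coeff H k) \<le> B"
    using fourier_coeff_bounded [OF hp] by blast
  have "c k = 0" for k
  proof -
    \<comment> \<open>The bound is read off at the indices k + m n, where c takes the same value
      while the power of q grows like a Gaussian, because n is negative.\<close>
    have "norm (c k) \<le> B * exp (- (pi * Im \<tau> * (real_of_int (k + of_nat m * n))\<^sup>2 / real_of_int (- n)))" for m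
    proof -
      let ?k = "k + of_nat m * n"
      let ?x = "pi * Im \<tau> * (real_of_int ?k)\<^sup>2 / real_of_int (- n)"
      have "norm (fourier_coeff H ?k) = norm (c k) * exp ?x"
        by (simp add: c(2) gaussian_coeffs_def norm_mult norm_q_pow periodic_int_add_mult [OF c(1)])
      then have "norm (c k) = norm (fourier_coeff H ?k) * exp (- ?x)"
        by (simp add: exp_minus)
      also have "\<dots> \<le> B * exp (- ?x)"
        by (intro mult_right_mono B) simp
      finally show ?thesis .
    qed
    moreover have "(\<lambda>m. B * exp (- (pi * Im \<tau> * (real_of_int (k + of_nat m * n))\<^sup>2 / real_of_int (- n))))
      \<longlonglongrightarrow> 0"
    proof -
      have *: "(\<lambda>m. B * exp (- (a * (x - real m * b)\<^sup>2 / b))) \<longlonglongrightarrow> 0" if "a > 0" "b > 0" for a b x :: real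
        using that by real_asymp
      show ?thesis
        using * [of "pi * Im \<tau>" "- real_of_int n" "real_of_int k"] assms by simp
    qed
    ultimately have "norm (c k) \<le> 0"
      by (intro LIMSEQ_le_const) auto
    then show ?thesis by simp
  qed
  then have "fourier_coeff H k = 0" for k
    by (simp add: c(2) gaussian_coeffs_def)
  \<comment> \<open>The zero family is summable, so the Fourier expansion applies and gives H =
    0.\<close>
  then have "H z = 0" for z
    using fourier_infsum [OF hp, of z] by simp
  then show "H \<in> {\<lambda>z. 0}" by auto
qed (simp add: theta_space_def periodic_entire_def)

section \<open>Holomorphic elements of fixed weight\<close>

theorem lemma5p3:
  fixes \<tau> :: complex and n :: int
  assumes "Im \<tau> > 0"
  shows "(n < 0 \<longrightarrow> A_hol \<tau> \<inter> A_weight \<tau> n = {\<lambda>p. 0}) \<and>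
    (n > 0 \<longrightarrow>
      (\<exists>c :: (complex \<times> real \<Rightarrow> complex) \<Rightarrow> int \<Rightarrow> complex.
        bij_betw c (A_hol \<tau> \<inter> A_weight \<tau> n) (periodic_int n) \<and>
        (\<forall>f \<in> A_hol \<tau> \<inter> A_weight \<tau> n. \<forall>(z :: complex) (t :: real) (x :: real) (y :: real).
          z = of_real x + \<tau> * of_real y \<longrightarrow>
          (\<lambda>k :: int. c f k * q_pow \<tau> (of_int (k ^ 2) / of_int n)
              * exp (2 * of_real pi * \<i> * of_int k * z)) summable_on UNIV \<and>
          f (z, t) =
            exp (of_real pi * \<i> * of_int n *
                 (of_real (1 / Im \<tau> * t) + of_real (x * y) + \<tau> * of_real (y ^ 2)))
            * (\<Sum>\<^sub>\<infinity>k :: int. c f k * q_pow \<tau> (of_int (k ^ 2) / of_int n)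
                 * exp (2 * of_real pi * \<i> * of_int k * z)))))"
proof (intro conjI impI)
  assume "n < 0"
  then show "A_hol \<tau> \<inter> A_weight \<tau> n = {\<lambda>p. 0}"
    using assms by (auto simp: hol_weight_eq theta_space_negative heis_lift_def fun_eq_iff)
next
  assume n: "n > 0"
  \<comment> \<open>The formula runs from coefficients to functions, so the required map c is the
    inverse of this one.\<close>
  define \<Psi> where "\<Psi> c = heis_lift \<tau> n (fourier_series (gaussian_coeffs \<tau> n c))" for c
  have bij: "bij_betw \<Psi> (periodic_int n) (A_hol \<tau> \<inter> A_weight \<tau> n)"
    unfolding hol_weight_eq [OF assms] \<Psi>_def
    by (rule bij_betw_trans [OF theta_series_bij_betw [OF assms n], unfolded o_def])
       (rule inj_on_imp_bij_betw [OF inj_on_subset [OF inj_heis_lift subset_UNIV]])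
  define c where "c = inv_into (periodic_int n) \<Psi>"
  have c: "bij_betw c (A_hol \<tau> \<inter> A_weight \<tau> n) (periodic_int n)"
    unfolding c_def using bij by (rule bij_betw_inv_into)
  let ?term = "\<lambda>f z k. c f k * q_pow \<tau> (of_int (k ^ 2) / of_int n)
                 * exp (2 * of_real pi * \<i> * of_int k * z)"
  have "(\<lambda>k. ?term f z k) summable_on UNIV \<and>
      f (z, t) = exp (of_real pi * \<i> * of_int n *
          (of_real (1 / Im \<tau> * t) + of_real (x * y) + \<tau> * of_real (y ^ 2)))
        * (\<Sum>\<^sub>\<infinity>k. ?term f z k)"
    if f: "f \<in> A_hol \<tau> \<inter> A_weight \<tau> n" and z: "z = of_real x + \<tau> * of_real y" for f z t x y
  proof -
    have cf: "c f \<in> periodic_int n"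
      using c f by (rule bij_betwE [rule_format])
    have "f = \<Psi> (c f)"
      unfolding c_def using bij_betw_inv_into_right [OF bij f] by simp
    then have "f (z, t) = \<Psi> (c f) (z, t)" by (rule fun_cong)
    \<comment> \<open>As x and y are real, z determines y; this matches the coordinate-free exponent
      with the one in x and y.\<close>
    moreover have "Im z / Im \<tau> = y"
      using assms by (simp add: z)
    then have "heis_exponent \<tau> n (z, t) = of_real pi * \<i> * of_int n *
        (of_real (1 / Im \<tau> * t) + of_real (x * y) + \<tau> * of_real (y ^ 2))"
      by (simp add: heis_exponent_def z algebra_simps power2_eq_square)
    moreover have "(\<lambda>k. ?term f z k) summable_on UNIV"
      using fourier_series_summable [OF gaussian_coeffs_rapidly_decreasing [OF assms n cf], of z]
      by (simp add: gaussian_coeffs_def fmode_def)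
    ultimately show ?thesis
      by (simp add: \<Psi>_def heis_lift_def fourier_series_def gaussian_coeffs_def fmode_def)
  qed
  with c show "\<exists>c. bij_betw c (A_hol \<tau> \<inter> A_weight \<tau> n) (periodic_int n) \<and>
      (\<forall>f \<in> A_hol \<tau> \<inter> A_weight \<tau> n. \<forall>z t x y. z = of_real x + \<tau> * of_real y \<longrightarrow>
        (\<lambda>k. c f k * q_pow \<tau> (of_int (k ^ 2) / of_int n)
            * exp (2 * of_real pi * \<i> * of_int k * z)) summable_on UNIV \<and>
        f (z, t) = exp (of_real pi * \<i> * of_int n *
            (of_real (1 / Im \<tau> * t) + of_real (x * y) + \<tau> * of_real (y ^ 2)))
          * (\<Sum>\<^sub>\<infinity>k. c f k * q_pow \<tau> (of_int (k ^ 2) / of_int n)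
            * exp (2 * of_real pi * \<i> * of_int k * z)))"
    by blast
qed

end
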